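(* Let $X$ be a finite connected simplicial complex, and let $f\colon X\to\mathbb{R}^n$ and $g\colon X\to S^m$ be PL-embeddings. Form the cones $c(f(X))$ and $C(g(X))$, and consider the canonical homeomorphism $$\Psi\colon c(f(X))\to C(g(X)),\qquad (hf(x),h)\mapsto hg(x)\quad(x\in X,\ h\ge0).$$ Equip each cone with either the subspace metric, i.e. the restriction of the metric of $\mathbb{R}^{n+1}$ respectively $\mathbb{R}^{m+1}$, or with the induced path metric. Then $\Psi$, and the identity maps $\mathrm{id}_{c(f(X))}$ and $\mathrm{id}_{C(g(X))}$ regarded as maps between the cone with one of these metrics and the same cone with the other, are bilipschitz homeomorphisms (for each choice of the metrics). In particular, the bilipschitz class of the cone does not depend on the chosen PL-embedding, nor on whether the cone with spherical base $C(g(X))$ or the cone with flat base $c(f(X))$ is used, nor on whether the subspace metric or the induced path metric is used. The same result applies to $c_R(f(X))$ for fixed $R>0$.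
   Context: For $Y$ a subset of the unit sphere of a real Hilbert space, the metric cone with spherical base is $C(Y)=\{ty: t\ge0,\ y\in Y\}$. For $Y$ a subset of a real Hilbert space $H$, the metric cone with flat base is $c(Y)=\{(hy,h): h\ge0,\ y\in Y\}\subset H\times\mathbb{R}$, and $c_R(Y)=c(Y)\cap(H\times[R,\infty))$ is the part of height at least $R$ (to be compared, via $\Psi$, with the part $\{tg(x): t\ge R,\ x\in X\}$ of $C(g(X))$). A PL-embedding is a piecewise linear embedding (with $S^m$ carrying its standard PL structure). The induced path metric is the infimum of lengths of paths in the subspace. A bilipschitz homeomorphism is an invertible Lipschitz map with Lipschitz inverse. *)

theory Defs
  imports "HOL-Analysis.Analysis"
begin

section \<open>Piecewise linear embeddings of finite simplicial complexes\<close>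

text \<open>
  A finite simplicial complex is a \<^const>\<open>simplicial_complex\<close> \<open>K\<close> in some Euclidean space; the
  underlying space is \<open>\<Union>K\<close>. A map on it is piecewise linear if it is affine on every simplex
  of some (finite) simplicial subdivision \<open>T\<close> of \<open>K\<close>.
\<close>

definition pl_map :: "'a::euclidean_space set set \<Rightarrow> ('a \<Rightarrow> 'b::euclidean_space) \<Rightarrow> bool" where
  "pl_map K f \<longleftrightarrow>
     (\<exists>T. simplicial_complex T \<and> \<Union>T = \<Union>K \<and> (\<forall>S\<in>T. \<exists>S'\<in>K. S \<subseteq> S') \<and>
          (\<forall>S\<in>T. \<exists>L c. linear L \<and> (\<forall>x\<in>S. f x = L x + c)))"

definition pl_embedding :: "'a::euclidean_space set set \<Rightarrow> ('a \<Rightarrow> 'b::euclidean_space) \<Rightarrow> bool" where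
  "pl_embedding K f \<longleftrightarrow> pl_map K f \<and> embedding_map (top_of_set (\<Union>K)) euclidean f"

text \<open>
  The standard PL structure on the unit sphere is the one transported from the boundary of a
  convex polytope \<open>P\<close> (a simplex, a cube, \dots) with the origin in its interior along the radial
  projection \<^term>\<open>sgn\<close>, that is \<open>y \<mapsto> y / norm y\<close>, which maps \<^term>\<open>frontier P\<close>
  homeomorphically onto the sphere. Different \<open>P\<close> give isomorphic but not literally equal
  structures, because radial projection between two such boundaries is not PL in general; a map
  that is PL for any one of these structures is admitted. The target is the unit sphere of a
  space of dimension \<open>m + 1\<close>.
\<close>

definition pl_map_sphere :: "'a::euclidean_space set set \<Rightarrow> ('a \<Rightarrow> 'b::euclidean_space) \<Rightarrow> bool" where
  "pl_map_sphere K g \<longleftrightarrow>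
     g ` \<Union>K \<subseteq> sphere 0 1 \<and>
     (\<exists>P k. polytope P \<and> 0 \<in> interior P \<and>
            pl_map K k \<and> k ` \<Union>K \<subseteq> frontier P \<and> (\<forall>x\<in>\<Union>K. g x = sgn (k x)))"

definition pl_embedding_sphere :: "'a::euclidean_space set set \<Rightarrow> ('a \<Rightarrow> 'b::euclidean_space) \<Rightarrow> bool" where
  "pl_embedding_sphere K g \<longleftrightarrow>
     pl_map_sphere K g \<and> embedding_map (top_of_set (\<Union>K)) euclidean g"


section \<open>Metric cones and the canonical map between them\<close>

definition spherical_cone :: "'a::real_vector set \<Rightarrow> 'a set" where
  "spherical_cone Y = {t *\<^sub>R y | t y. t \<ge> 0 \<and> y \<in> Y}"

definition flat_cone :: "'a::real_vector set \<Rightarrow> ('a \<times> real) set" where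
  "flat_cone Y = {(h *\<^sub>R y, h) | h y. h \<ge> 0 \<and> y \<in> Y}"

definition spherical_cone_from :: "real \<Rightarrow> 'a::real_vector set \<Rightarrow> 'a set" where
  "spherical_cone_from R Y = {t *\<^sub>R y | t y. t \<ge> R \<and> y \<in> Y}"

definition flat_cone_from :: "real \<Rightarrow> 'a::real_vector set \<Rightarrow> ('a \<times> real) set" where
  "flat_cone_from R Y = flat_cone Y \<inter> (UNIV \<times> {R..})"

text \<open>
  The map \<open>(h f(x), h) \<mapsto> h g(x)\<close>. At the apex the value of the inverse of \<open>f\<close> is irrelevant, as it
  is multiplied by \<open>0\<close>.
\<close>

definition cone_map ::
    "'a set \<Rightarrow> ('a \<Rightarrow> 'b::real_vector) \<Rightarrow> ('a \<Rightarrow> 'c::real_vector) \<Rightarrow> 'b \<times> real \<Rightarrow> 'c" where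
  "cone_map X f g = (\<lambda>(v, h). h *\<^sub>R g (the_inv_into X f (v /\<^sub>R h)))"

lemma cone_map_eq:
  assumes "inj_on f X" "x \<in> X"
  shows "cone_map X f g (h *\<^sub>R f x, h) = h *\<^sub>R g x"
  using assms by (cases "h = 0") (auto simp: cone_map_def the_inv_into_f_f)


section \<open>The induced path metric\<close>

definition path_length :: "(real \<Rightarrow> 'a::metric_space) \<Rightarrow> ennreal" where
  "path_length \<gamma> =
     (SUP (N, t) \<in> {(N :: nat, t :: nat \<Rightarrow> real). incseq t \<and> range t \<subseteq> {0..1}}.
        ennreal (\<Sum>i<N. dist (\<gamma> (t i)) (\<gamma> (t (Suc i)))))"

text \<open>The value is \<open>\<infinity>\<close> if no path of finite length in \<open>S\<close> joins the two points.\<close>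

definition path_dist :: "'a::metric_space set \<Rightarrow> 'a \<Rightarrow> 'a \<Rightarrow> ennreal" where
  "path_dist S x y =
     (INF \<gamma> \<in> {\<gamma>. path \<gamma> \<and> path_image \<gamma> \<subseteq> S \<and> pathstart \<gamma> = x \<and> pathfinish \<gamma> = y}. path_length \<gamma>)"

definition rectifiably_connected :: "'a::metric_space set \<Rightarrow> bool" where
  "rectifiably_connected S \<longleftrightarrow> (\<forall>x\<in>S. \<forall>y\<in>S. path_dist S x y < \<infinity>)"

text \<open>This is meaningful only for rectifiably connected \<open>S\<close>; see \<open>Metric_space_path_dist\<close> below.\<close>

definition path_metric :: "'a::metric_space set \<Rightarrow> 'a metric" where
  "path_metric S = metric (S, \<lambda>x y. enn2real (path_dist S x y))"

lemma path_length_ge_sum: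
  assumes "incseq t" "range t \<subseteq> {0..1::real}"
  shows "ennreal (\<Sum>i<N. dist (\<gamma> (t i)) (\<gamma> (t (Suc i)))) \<le> path_length \<gamma>"
  unfolding path_length_def by (rule SUP_upper2[of "(N, t)"]) (use assms in auto)

lemma path_length_leI:
  assumes "\<And>N t. incseq t \<Longrightarrow> range t \<subseteq> {0..1::real} \<Longrightarrow>
             ennreal (\<Sum>i<N. dist (\<gamma> (t i)) (\<gamma> (t (Suc i)))) \<le> B"
  shows "path_length \<gamma> \<le> B"
  unfolding path_length_def by (rule SUP_least) (use assms in auto)

lemma dist_le_path_length: "ennreal (dist (pathstart \<gamma>) (pathfinish \<gamma>)) \<le> path_length \<gamma>"
proof -
  have "ennreal (\<Sum>i<1. dist (\<gamma> (min 1 (real i))) (\<gamma> (min 1 (real (Suc i))))) \<le> path_length \<gamma>"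
    by (rule path_length_ge_sum) (auto simp: incseq_def)
  thus ?thesis
    by (simp add: pathstart_def pathfinish_def)
qed

lemma dist_le_path_dist: "ennreal (dist x y) \<le> path_dist S x y"
  unfolding path_dist_def by (rule INF_greatest) (use dist_le_path_length in auto)

lemma path_dist_self:
  assumes "x \<in> S"
  shows "path_dist S x x = 0"
proof -
  have "path_dist S x x \<le> path_length (\<lambda>_. x)"
    unfolding path_dist_def
    by (rule INF_lower) (use assms in \<open>auto simp: path_def path_image_def pathstart_def pathfinish_def\<close>)
  also have "path_length (\<lambda>_::real. x) \<le> 0"
    by (rule path_length_leI) auto
  finally show ?thesis
    by simp
qed

lemma path_length_reversepath_le: "path_length (reversepath \<gamma>) \<le> path_length \<gamma>"
proof (rule path_length_leI)
  fix N :: nat and t :: "nat \<Rightarrow> real"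
  assume t: "incseq t" "range t \<subseteq> {0..1}"
  define s where "s i = 1 - t (N - i)" for i
  have "(\<Sum>i<N. dist (reversepath \<gamma> (t i)) (reversepath \<gamma> (t (Suc i)))) =
        (\<Sum>i<N. dist (reversepath \<gamma> (t (N - Suc i))) (reversepath \<gamma> (t (Suc (N - Suc i)))))"
    by (rule sum.nat_diff_reindex [symmetric])
  also have "\<dots> = (\<Sum>i<N. dist (\<gamma> (s i)) (\<gamma> (s (Suc i))))"
    by (rule sum.cong) (auto simp: s_def reversepath_def dist_commute Suc_diff_Suc)
  finally have eq: "(\<Sum>i<N. dist (reversepath \<gamma> (t i)) (reversepath \<gamma> (t (Suc i)))) =
                    (\<Sum>i<N. dist (\<gamma> (s i)) (\<gamma> (s (Suc i))))" .
  have "incseq s"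
    unfolding s_def using t(1) by (auto simp: incseq_def)
  moreover have "range s \<subseteq> {0..1}"
    unfolding s_def using t(2) by (auto simp: image_subset_iff)
  ultimately show "ennreal (\<Sum>i<N. dist (reversepath \<gamma> (t i)) (reversepath \<gamma> (t (Suc i)))) \<le> path_length \<gamma>"
    unfolding eq by (rule path_length_ge_sum)
qed

lemma path_dist_le_commute: "path_dist S x y \<le> path_dist S y x"
  unfolding path_dist_def
proof (rule INF_greatest)
  fix \<gamma> assume g: "\<gamma> \<in> {\<gamma>. path \<gamma> \<and> path_image \<gamma> \<subseteq> S \<and> pathstart \<gamma> = y \<and> pathfinish \<gamma> = x}"
  show "(INF \<gamma>\<in>{\<gamma>. path \<gamma> \<and> path_image \<gamma> \<subseteq> S \<and> pathstart \<gamma> = x \<and> pathfinish \<gamma> = y}. path_length \<gamma>)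
          \<le> path_length \<gamma>"
    by (rule INF_lower2[of "reversepath \<gamma>"]) (use g path_length_reversepath_le in auto)
qed

lemma path_length_joinpaths_le:
  assumes "pathfinish \<gamma> = pathstart \<delta>"
  shows "path_length (\<gamma> +++ \<delta>) \<le> path_length \<gamma> + path_length \<delta>"
proof (rule path_length_leI)
  fix N :: nat and t :: "nat \<Rightarrow> real"
  assume t: "incseq t" "range t \<subseteq> {0..1}"
  define s where "s i = 2 * min (t i) (1/2)" for i
  define u where "u i = 2 * max (t i) (1/2) - 1" for i
  have st: "incseq s" "range s \<subseteq> {0..1}" "incseq u" "range u \<subseteq> {0..1}"
    unfolding s_def u_def using t
    by (auto simp: incseq_def image_subset_iff intro: min.coboundedI1 max.coboundedI1)
  have *: "\<gamma> 1 = \<delta> 0"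
    using assms by (simp add: pathstart_def pathfinish_def)
  have "dist ((\<gamma> +++ \<delta>) (t i)) ((\<gamma> +++ \<delta>) (t (Suc i))) \<le>
        dist (\<gamma> (s i)) (\<gamma> (s (Suc i))) + dist (\<delta> (u i)) (\<delta> (u (Suc i)))" for i
  proof -
    have le: "t i \<le> t (Suc i)"
      using t(1) by (simp add: incseq_SucD)
    consider "t (Suc i) \<le> 1/2" | "t i > 1/2" | "t i \<le> 1/2" "t (Suc i) > 1/2"
      by linarith
    thus ?thesis
    proof cases
      case 3
      thus ?thesis
        using dist_triangle[of "\<gamma> (2 * t i)" "\<delta> (2 * t (Suc i) - 1)" "\<delta> 0"] *
        by (simp add: joinpaths_def s_def u_def)
    qed (use le in \<open>auto simp: joinpaths_def s_def u_def\<close>)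
  qed
  hence "(\<Sum>i<N. dist ((\<gamma> +++ \<delta>) (t i)) ((\<gamma> +++ \<delta>) (t (Suc i)))) \<le>
         (\<Sum>i<N. dist (\<gamma> (s i)) (\<gamma> (s (Suc i)))) + (\<Sum>i<N. dist (\<delta> (u i)) (\<delta> (u (Suc i))))"
    by (simp add: sum.distrib [symmetric] sum_mono)
  hence "ennreal (\<Sum>i<N. dist ((\<gamma> +++ \<delta>) (t i)) ((\<gamma> +++ \<delta>) (t (Suc i)))) \<le>
         ennreal (\<Sum>i<N. dist (\<gamma> (s i)) (\<gamma> (s (Suc i)))) + ennreal (\<Sum>i<N. dist (\<delta> (u i)) (\<delta> (u (Suc i))))"
    by (simp add: ennreal_leI sum_nonneg flip: ennreal_plus)
  also have "\<dots> \<le> path_length \<gamma> + path_length \<delta>"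
    by (intro add_mono path_length_ge_sum st)
  finally show "ennreal (\<Sum>i<N. dist ((\<gamma> +++ \<delta>) (t i)) ((\<gamma> +++ \<delta>) (t (Suc i)))) \<le>
                path_length \<gamma> + path_length \<delta>" .
qed

lemma path_dist_less_iff:
  "path_dist S x y < B \<longleftrightarrow>
     (\<exists>\<gamma>. path \<gamma> \<and> path_image \<gamma> \<subseteq> S \<and> pathstart \<gamma> = x \<and> pathfinish \<gamma> = y \<and> path_length \<gamma> < B)"
  unfolding path_dist_def INF_less_iff by auto

lemma path_dist_triangle: "path_dist S x z \<le> path_dist S x y + path_dist S y z"
proof (rule ennreal_le_epsilon)
  fix e :: real assume fin: "path_dist S x y + path_dist S y z < top" and e: "0 < e"
  from fin have "path_dist S x y < path_dist S x y + ennreal (e/2)"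
                "path_dist S y z < path_dist S y z + ennreal (e/2)"
    using e by (simp_all add: ennreal_add_eq_top less_top ennreal_less_zero_iff)
  then have "\<exists>\<gamma>. path \<gamma> \<and> path_image \<gamma> \<subseteq> S \<and> pathstart \<gamma> = x \<and> pathfinish \<gamma> = y \<and>
                  path_length \<gamma> < path_dist S x y + ennreal (e/2)"
            "\<exists>\<delta>. path \<delta> \<and> path_image \<delta> \<subseteq> S \<and> pathstart \<delta> = y \<and> pathfinish \<delta> = z \<and>
                  path_length \<delta> < path_dist S y z + ennreal (e/2)"
    by (auto simp only: path_dist_less_iff)
  then obtain \<gamma> \<delta> where
    g: "path \<gamma>" "path_image \<gamma> \<subseteq> S" "pathstart \<gamma> = x" "pathfinish \<gamma> = y"
       "path_length \<gamma> < path_dist S x y + ennreal (e/2)" and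
    d: "path \<delta>" "path_image \<delta> \<subseteq> S" "pathstart \<delta> = y" "pathfinish \<delta> = z"
       "path_length \<delta> < path_dist S y z + ennreal (e/2)"
    by blast
  have "path_dist S x z \<le> path_length (\<gamma> +++ \<delta>)"
    unfolding path_dist_def by (rule INF_lower) (use g d in \<open>auto simp: path_image_join\<close>)
  also have "\<dots> \<le> path_length \<gamma> + path_length \<delta>"
    by (rule path_length_joinpaths_le) (use g d in simp)
  also have "\<dots> \<le> (path_dist S x y + ennreal (e/2)) + (path_dist S y z + ennreal (e/2))"
    using g d by (intro add_mono) auto
  also have "\<dots> = path_dist S x y + path_dist S y z + (ennreal (e/2) + ennreal (e/2))"
    by (simp add: algebra_simps)
  also have "ennreal (e/2) + ennreal (e/2) = ennreal e"
    using e by (simp flip: ennreal_plus)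
  finally show "path_dist S x z \<le> path_dist S x y + path_dist S y z + ennreal e" .
qed

lemma Metric_space_path_dist:
  assumes "rectifiably_connected S"
  shows "Metric_space S (\<lambda>x y. enn2real (path_dist S x y))"
proof
  have fin: "path_dist S x y < top" if "x \<in> S" "y \<in> S" for x y
    using assms that by (auto simp: rectifiably_connected_def)
  show "enn2real (path_dist S x y) = enn2real (path_dist S y x)" for x y
    using path_dist_le_commute[of S x y] path_dist_le_commute[of S y x] by simp
  show "(enn2real (path_dist S x y) = 0) = (x = y)" if "x \<in> S" "y \<in> S" for x y
  proof
    assume "enn2real (path_dist S x y) = 0"
    hence "path_dist S x y = 0"
      using fin[OF that] by (auto simp: enn2real_eq_0_iff)
    thus "x = y"
      using dist_le_path_dist[of x y S] by (simp add: ennreal_eq_0_iff)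
  qed (use that in \<open>simp add: path_dist_self\<close>)
  show "enn2real (path_dist S x z) \<le> enn2real (path_dist S x y) + enn2real (path_dist S y z)"
    if "x \<in> S" "y \<in> S" "z \<in> S" for x y z
  proof -
    have "enn2real (path_dist S x z) \<le> enn2real (path_dist S x y + path_dist S y z)"
      using path_dist_triangle[of S x z y] fin that by (intro enn2real_mono) auto
    thus ?thesis
      using fin that by (simp add: enn2real_plus)
  qed
qed auto

lemma mspace_path_metric: "rectifiably_connected S \<Longrightarrow> mspace (path_metric S) = S"
  and mdist_path_metric:
    "rectifiably_connected S \<Longrightarrow> mdist (path_metric S) x y = enn2real (path_dist S x y)"
  by (simp_all add: path_metric_def Metric_space.mspace_metric Metric_space.mdist_metric
        Metric_space_path_dist)


section \<open>Bilipschitz homeomorphisms\<close>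

definition bilipschitz_homeomorphism :: "'a metric \<Rightarrow> 'b metric \<Rightarrow> ('a \<Rightarrow> 'b) \<Rightarrow> bool" where
  "bilipschitz_homeomorphism m1 m2 \<phi> \<longleftrightarrow>
     Lipschitz_continuous_map m1 m2 \<phi> \<and>
     (\<exists>\<psi>. Lipschitz_continuous_map m2 m1 \<psi> \<and>
          (\<forall>x\<in>mspace m1. \<psi> (\<phi> x) = x) \<and> (\<forall>y\<in>mspace m2. \<phi> (\<psi> y) = y))"

text \<open>The two metrics considered on a cone: the subspace metric and the induced path metric.\<close>

definition cone_metrics :: "'a::metric_space set \<Rightarrow> 'a metric set" where
  "cone_metrics S = {submetric euclidean_metric S, path_metric S}"

definition bilipschitz_for_all_metrics ::
    "'a::metric_space set \<Rightarrow> 'b::metric_space set \<Rightarrow> ('a \<Rightarrow> 'b) \<Rightarrow> bool" where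
  "bilipschitz_for_all_metrics S T \<phi> \<longleftrightarrow>
     (\<forall>m1\<in>cone_metrics S. \<forall>m2\<in>cone_metrics T. bilipschitz_homeomorphism m1 m2 \<phi>)"

definition same_bilipschitz_class :: "'a::metric_space set \<Rightarrow> 'b::metric_space set \<Rightarrow> bool" where
  "same_bilipschitz_class S T \<longleftrightarrow>
     (\<forall>m1\<in>cone_metrics S. \<forall>m2\<in>cone_metrics T. \<exists>\<phi>. bilipschitz_homeomorphism m1 m2 \<phi>)"

text \<open>
  The finiteness of the path distances is part of the assertion: it is what makes the induced
  path metrics well defined.
\<close>

definition cones_comparable ::
    "'a::metric_space set \<Rightarrow> 'b::metric_space set \<Rightarrow> ('a \<Rightarrow> 'b) \<Rightarrow> bool" where
  "cones_comparable S T \<Psi> \<longleftrightarrow>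
     rectifiably_connected S \<and> rectifiably_connected T \<and>
     bilipschitz_for_all_metrics S T \<Psi> \<and>
     bilipschitz_for_all_metrics S S id \<and>
     bilipschitz_for_all_metrics T T id"

end

theory Submission
  imports Defs
begin

text \<open>
  Let \<open>X = \<Union>K\<close> with the Euclidean distance of the ambient space of \<open>K\<close>. Every cone in question is
  parametrised by \<open>(x, h) \<mapsto> h *\<^sub>R G x\<close> with \<open>x \<in> X\<close> and \<open>h \<ge> R\<close>, where \<open>G x = (f x, 1)\<close> for a flat
  cone, \<open>G = g\<close> for a spherical one, and \<open>R = 0\<close> for a full cone. In these coordinates both the
  subspace metric and the path metric turn out to be comparable, up to constant factors, to
  \<open>\<bar>h - k\<bar> + min h k * dist x y\<close>. This expression depends neither on the embedding nor on the kind
  of cone nor on the kind of metric, so all the maps \<open>h *\<^sub>R G x \<mapsto> h *\<^sub>R G' x\<close> are bilipschitz.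

  The comparison (\<open>cone_over_bilipschitz_embedding_charted\<close>) needs two properties of \<open>X\<close> and \<open>G\<close>.
  First, \<open>X\<close> is quasiconvex: two of its points are joined within \<open>X\<close> by paths whose length exceeds
  their distance at most by a constant factor. Second, \<open>G\<close> is bilipschitz on \<open>X\<close>. Both come from
  one principle (\<open>pseudometric_le_dist_on_polytopes\<close>): on a finite union of polytopes, a
  pseudometric that is bounded by a multiple of the distance on each polytope is bounded by a
  multiple of the distance globally. It is applied to the path metric of \<open>X\<close>, to the distance
  pulled back along a piecewise linear map, and to the distance pulled back along its inverse. For a
  spherical embedding it remains to see that radial projection from the boundary of a convex body
  to the sphere is bilipschitz (\<open>sgn_bilipschitz_on_frontier\<close>).

  The principle rests on the linear regularity of polyhedra (\<open>polyhedra_linear_regularity\<close>): if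
  \<open>S\<close> and \<open>T\<close> meet, one can go from \<open>x \<in> S\<close> to \<open>y \<in> T\<close> through a point of \<open>S \<inter> T\<close> whose distance
  from \<open>x\<close> is at most a constant times \<open>dist x y\<close>. This follows from an error bound for finite
  systems of linear inequalities (\<open>hoffman_error_bound\<close>).
\<close>

section \<open>Linear regularity of polyhedra\<close>

text \<open>
  The vectors \<open>w\<close> considered here form the polar of the cone \<open>{u. \<forall>i\<in>J. a i \<bullet> u \<le> 0}\<close>. A nonzero \<open>w\<close>
  in the polar cannot lie in the cone itself, as then \<open>w \<bullet> w \<le> 0\<close>; so some \<open>a i \<bullet> w\<close> is positive,
  and by compactness of the unit sphere it is at least a fixed multiple of the norm of \<open>w\<close>.
\<close>

lemma polar_vector_norm_bound:
  fixes a :: "'i \<Rightarrow> 'a::euclidean_space"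
  assumes "finite J"
  shows "\<exists>C\<ge>0. \<forall>w m. (\<forall>u. (\<forall>i\<in>J. a i \<bullet> u \<le> 0) \<longrightarrow> w \<bullet> u \<le> 0) \<longrightarrow> m \<ge> 0 \<longrightarrow> (\<forall>i\<in>J. a i \<bullet> w \<le> m)
            \<longrightarrow> norm w \<le> C * m"
proof -
  define N where "N = {w. \<forall>u. (\<forall>i\<in>J. a i \<bullet> u \<le> 0) \<longrightarrow> w \<bullet> u \<le> 0}"
  define \<sigma> where "\<sigma> w = (\<Sum>i\<in>J. max 0 (a i \<bullet> w))" for w
  have N_eq: "N = (\<Inter>u\<in>{u. \<forall>i\<in>J. a i \<bullet> u \<le> 0}. {w. u \<bullet> w \<le> 0})"
    by (auto simp: N_def inner_commute)
  have "closed N"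
    unfolding N_eq by (intro closed_INT ballI closed_halfspace_le)
  hence cpt: "compact (N \<inter> sphere 0 1)"
    by (intro closed_Int_compact) auto
  have pos: "\<sigma> w > 0" if "w \<in> N" "w \<noteq> 0" for w
  proof (rule ccontr)
    assume "\<not> \<sigma> w > 0"
    moreover have "\<sigma> w \<ge> 0"
      unfolding \<sigma>_def by (intro sum_nonneg) auto
    ultimately have "\<sigma> w = 0"
      by simp
    hence "\<forall>i\<in>J. max 0 (a i \<bullet> w) = 0"
      unfolding \<sigma>_def by (subst (asm) sum_nonneg_eq_0_iff) (use assms in auto)
    hence "\<forall>i\<in>J. a i \<bullet> w \<le> 0"
      by (auto simp: max_def split: if_splits)
    with that(1) have "w \<bullet> w \<le> 0"
      by (auto simp: N_def)
    with that(2) show False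
      by (metis inner_gt_zero_iff not_le)
  qed
  have "\<exists>c>0. \<forall>w\<in>N \<inter> sphere 0 1. c \<le> \<sigma> w"
  proof (cases "N \<inter> sphere 0 1 = {}")
    case False
    have "continuous_on (N \<inter> sphere 0 1) \<sigma>"
      unfolding \<sigma>_def by (intro continuous_intros)
    from continuous_attains_inf[OF cpt False this] obtain w0 where
      w0: "w0 \<in> N \<inter> sphere 0 1" "\<forall>w\<in>N \<inter> sphere 0 1. \<sigma> w0 \<le> \<sigma> w"
      by blast
    moreover have "w0 \<noteq> 0"
      using w0 by auto
    ultimately show ?thesis
      using pos[of w0] by blast
  qed (auto intro: exI[of _ 1])
  then obtain c where c: "c > 0" "\<And>w. w \<in> N \<inter> sphere 0 1 \<Longrightarrow> c \<le> \<sigma> w"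
    by blast
  have "norm w \<le> card J / c * m" if w: "w \<in> N" and m: "m \<ge> 0" "\<forall>i\<in>J. a i \<bullet> w \<le> m" for w m
  proof (cases "w = 0")
    case False
    have "w /\<^sub>R norm w \<in> N"
      using w False by (auto simp: N_def mult_nonneg_nonpos)
    hence "c \<le> \<sigma> (w /\<^sub>R norm w)"
      using False by (intro c) auto
    also have "\<sigma> (w /\<^sub>R norm w) = (\<Sum>i\<in>J. max 0 (a i \<bullet> w) / norm w)"
      unfolding \<sigma>_def using False
      by (intro sum.cong) (auto simp: max_def field_simps zero_le_mult_iff mult_le_0_iff)
    also have "\<dots> \<le> (\<Sum>i\<in>J. m / norm w)"
      using m by (intro sum_mono divide_right_mono) auto
    finally show ?thesis
      using False c(1) by (simp add: field_simps)
  qed (use m c in auto)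
  thus ?thesis
    using c(1) by (intro exI[of _ "card J / c"]) (auto simp: N_def)
qed

text \<open>
  Let \<open>p\<close> be the solution closest to \<open>x\<close> and \<open>J\<close> the set of constraints active at \<open>p\<close>. Then \<open>x - p\<close>
  lies in the polar of the tangent cone at \<open>p\<close>, which is cut out by the constraints in \<open>J\<close>, so its
  norm is controlled by the violation of these constraints. The constant is uniform because there
  are only finitely many possible sets \<open>J\<close>.
\<close>

lemma hoffman_error_bound:
  fixes a :: "'i \<Rightarrow> 'a::euclidean_space" and b :: "'i \<Rightarrow> real"
  assumes fin: "finite I" and ne: "{x. \<forall>i\<in>I. a i \<bullet> x \<le> b i} \<noteq> {}"
  shows "\<exists>C\<ge>0. \<forall>x m. m \<ge> 0 \<longrightarrow> (\<forall>i\<in>I. a i \<bullet> x \<le> b i + m) \<longrightarrow>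
            (\<exists>p. (\<forall>i\<in>I. a i \<bullet> p \<le> b i) \<and> dist x p \<le> C * m)"
proof -
  have "\<exists>C\<ge>0. \<forall>w m. (\<forall>u. (\<forall>i\<in>J. a i \<bullet> u \<le> 0) \<longrightarrow> w \<bullet> u \<le> 0) \<longrightarrow> m \<ge> 0 \<longrightarrow> (\<forall>i\<in>J. a i \<bullet> w \<le> m)
            \<longrightarrow> norm w \<le> C * m" if "J \<in> Pow I" for J
    using polar_vector_norm_bound[of J a] that fin finite_subset by blast
  then obtain C where C0: "\<And>J. J \<in> Pow I \<Longrightarrow> C J \<ge> 0" and
    C: "\<And>J w m. J \<in> Pow I \<Longrightarrow> (\<And>u. (\<forall>i\<in>J. a i \<bullet> u \<le> 0) \<Longrightarrow> w \<bullet> u \<le> 0) \<Longrightarrow> m \<ge> 0 \<Longrightarrow>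
           (\<forall>i\<in>J. a i \<bullet> w \<le> m) \<Longrightarrow> norm w \<le> C J * m"
    by metis
  define P where "P = {x. \<forall>i\<in>I. a i \<bullet> x \<le> b i}"
  have P_eq: "P = (\<Inter>i\<in>I. {x. a i \<bullet> x \<le> b i})"
    by (auto simp: P_def)
  have "closed P"
    unfolding P_eq by (intro closed_INT ballI closed_halfspace_le)
  have "convex P"
    unfolding P_eq by (intro convex_INT convex_halfspace_le)
  have "P \<noteq> {}"
    using ne by (simp add: P_def)
  have "\<exists>p. (\<forall>i\<in>I. a i \<bullet> p \<le> b i) \<and> dist x p \<le> sum C (Pow I) * m"
    if m: "m \<ge> 0" "\<forall>i\<in>I. a i \<bullet> x \<le> b i + m" for x m
  proof -
    define p where "p = closest_point P x"
    define J where "J = {i\<in>I. a i \<bullet> p = b i}"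
    have "p \<in> P"
      unfolding p_def using \<open>closed P\<close> \<open>P \<noteq> {}\<close> by (rule closest_point_in_set)
    have polar: "(x - p) \<bullet> u \<le> 0" if u: "\<forall>i\<in>J. a i \<bullet> u \<le> 0" for u
    proof -
      \<comment> \<open>A short step from \<open>p\<close> in a direction of the tangent cone stays in \<open>P\<close>: active constraints
          are preserved, and the inactive ones hold with some slack.\<close>
      have "\<forall>\<^sub>F e in at_right 0. a i \<bullet> (p + e *\<^sub>R u) \<le> b i" if "i \<in> I" for i
      proof (cases "i \<in> J")
        case True
        show ?thesis
          using eventually_at_right_less[of "0::real"]
          by eventually_elim (use True u in \<open>auto simp: J_def inner_add_right mult_nonneg_nonpos\<close>)
      next
        case False
        hence "a i \<bullet> p < b i"
          using that \<open>p \<in> P\<close> by (auto simp: J_def P_def less_le)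
        moreover have "((\<lambda>e. a i \<bullet> (p + e *\<^sub>R u)) \<longlongrightarrow> a i \<bullet> (p + 0 *\<^sub>R u)) (at_right 0)"
          by (intro tendsto_intros)
        ultimately have "\<forall>\<^sub>F e in at_right 0. a i \<bullet> (p + e *\<^sub>R u) < b i"
          by (intro order_tendstoD) auto
        thus ?thesis
          by eventually_elim simp
      qed
      hence "\<forall>\<^sub>F e in at_right 0. \<forall>i\<in>I. a i \<bullet> (p + e *\<^sub>R u) \<le> b i"
        by (intro eventually_ball_finite fin) auto
      hence "\<forall>\<^sub>F e in at_right 0. e > 0 \<and> (\<forall>i\<in>I. a i \<bullet> (p + e *\<^sub>R u) \<le> b i)"
        by (intro eventually_conj eventually_at_right_less)
      from eventually_happens[OF this]
      obtain e where e: "e > (0::real)" "\<forall>i\<in>I. a i \<bullet> (p + e *\<^sub>R u) \<le> b i"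
        by auto
      have "(x - p) \<bullet> (p + e *\<^sub>R u - p) \<le> 0"
        unfolding p_def using e by (intro closest_point_dot \<open>convex P\<close> \<open>closed P\<close>) (auto simp: P_def p_def)
      thus ?thesis
        using e(1) by (simp add: mult_le_0_iff)
    qed
    have "J \<in> Pow I"
      by (auto simp: J_def)
    have "norm (x - p) \<le> C J * m"
      using \<open>J \<in> Pow I\<close> polar m(1)
    proof (rule C)
      show "\<forall>i\<in>J. a i \<bullet> (x - p) \<le> m"
        using m(2) by (fastforce simp: J_def inner_diff_right)
    qed
    also have "\<dots> \<le> sum C (Pow I) * m"
      using m(1) fin \<open>J \<in> Pow I\<close> C0 by (intro mult_right_mono member_le_sum) auto
    finally show ?thesis
      using \<open>p \<in> P\<close> by (auto simp: P_def dist_norm)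
  qed
  moreover have "sum C (Pow I) \<ge> 0"
    by (intro sum_nonneg C0)
  ultimately show ?thesis
    by blast
qed

lemma polyhedron_finite_inequalities:
  fixes S :: "'a::euclidean_space set"
  assumes "polyhedron S"
  shows "\<exists>A. finite A \<and> S = {x. \<forall>i\<in>A. fst i \<bullet> x \<le> snd i}"
proof -
  obtain F where F: "finite F" "S = \<Inter>F" "\<forall>h\<in>F. \<exists>a b. a \<noteq> 0 \<and> h = {x. a \<bullet> x \<le> b}"
    using assms unfolding polyhedron_def by blast
  then obtain a b where "\<forall>h\<in>F. h = {x. a h \<bullet> x \<le> b h}"
    by metis
  hence "S = {x. \<forall>i\<in>(\<lambda>h. (a h, b h)) ` F. fst i \<bullet> x \<le> snd i}"
    using F(2) by auto
  thus ?thesis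
    using F(1) by blast
qed

text \<open>
  Two polyhedra that meet do so at a positive angle: a point of one that is close to the other
  violates the inequalities of the other only slightly, so it is close to the intersection.
\<close>

lemma polyhedra_linear_regularity:
  fixes S T :: "'a::euclidean_space set"
  assumes "polyhedron S" "polyhedron T" "S \<inter> T \<noteq> {}"
  shows "\<exists>C\<ge>0. \<forall>x\<in>S. \<forall>y\<in>T. \<exists>z\<in>S \<inter> T. dist x z \<le> C * dist x y"
proof -
  obtain A where A: "finite A" "S = {x. \<forall>i\<in>A. fst i \<bullet> x \<le> snd i}"
    using polyhedron_finite_inequalities[OF assms(1)] by blast
  obtain B where B: "finite B" "T = {x. \<forall>i\<in>B. fst i \<bullet> x \<le> snd i}"
    using polyhedron_finite_inequalities[OF assms(2)] by blast
  have eq: "(\<forall>i\<in>A \<union> B. fst i \<bullet> x \<le> snd i) \<longleftrightarrow> x \<in> S \<inter> T" for x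
    using A B by auto
  have "\<exists>C\<ge>0. \<forall>x m. m \<ge> 0 \<longrightarrow> (\<forall>i\<in>A \<union> B. fst i \<bullet> x \<le> snd i + m) \<longrightarrow>
          (\<exists>p. p \<in> S \<inter> T \<and> dist x p \<le> C * m)"
    using hoffman_error_bound[of "A \<union> B" fst snd, unfolded eq Collect_mem_eq] A(1) B(1) assms(3)
    by simp
  then obtain C where C: "C \<ge> 0"
    "\<And>x m. m \<ge> 0 \<Longrightarrow> (\<forall>i\<in>A \<union> B. fst i \<bullet> x \<le> snd i + m) \<Longrightarrow> \<exists>p\<in>S \<inter> T. dist x p \<le> C * m"
    by blast
  define M where "M = (\<Sum>i\<in>B. norm (fst i))"
  have "M \<ge> 0"
    unfolding M_def by (intro sum_nonneg) auto
  have "\<exists>z\<in>S \<inter> T. dist x z \<le> C * (M * dist x y)" if "x \<in> S" "y \<in> T" for x y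
  proof (rule C(2))
    show "\<forall>i\<in>A \<union> B. fst i \<bullet> x \<le> snd i + M * dist x y"
    proof
      fix i assume i: "i \<in> A \<union> B"
      show "fst i \<bullet> x \<le> snd i + M * dist x y"
      proof (cases "i \<in> A")
        case True
        hence "fst i \<bullet> x \<le> snd i"
          using \<open>x \<in> S\<close> A(2) by blast
        moreover have "M * dist x y \<ge> 0"
          using \<open>M \<ge> 0\<close> by simp
        ultimately show ?thesis
          by linarith
      next
        case False
        hence "i \<in> B"
          using i by simp
        have "fst i \<bullet> (x - y) \<le> norm (fst i) * dist x y"
          by (metis dist_norm norm_cauchy_schwarz)
        also have "\<dots> \<le> M * dist x y"
          unfolding M_def using B(1) \<open>i \<in> B\<close> by (intro mult_right_mono member_le_sum) auto
        finally have "fst i \<bullet> x - fst i \<bullet> y \<le> M * dist x y"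
          by (simp add: inner_diff_right)
        moreover have "fst i \<bullet> y \<le> snd i"
          using \<open>y \<in> T\<close> \<open>i \<in> B\<close> B(2) by blast
        ultimately show ?thesis
          by linarith
      qed
    qed
  qed (use \<open>M \<ge> 0\<close> in auto)
  thus ?thesis
    using C(1) \<open>M \<ge> 0\<close> by (intro exI[of _ "C * M"]) (simp add: mult.assoc)
qed

section \<open>Comparing metrics on a finite union of polytopes\<close>

text \<open>
  This is the one place where local estimates become global. For \<open>x \<in> S\<close> and \<open>y \<in> T\<close> with
  \<open>S \<inter> T \<noteq> {}\<close> one passes through a point of \<open>S \<inter> T\<close> supplied by linear regularity; if
  \<open>S \<inter> T = {}\<close>, then \<open>d\<close> is bounded on \<open>S \<times> T\<close> while the distance is bounded below.
\<close>

lemma pseudometric_le_dist_on_polytopes: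
  fixes d :: "'a::euclidean_space \<Rightarrow> 'a \<Rightarrow> real"
  assumes fin: "finite \<T>" and poly: "\<And>S. S \<in> \<T> \<Longrightarrow> polytope S"
    and local_bound: "\<And>S. S \<in> \<T> \<Longrightarrow> \<exists>L. \<forall>x\<in>S. \<forall>y\<in>S. d x y \<le> L * dist x y"
    and tri: "\<And>x y z. x \<in> \<Union>\<T> \<Longrightarrow> y \<in> \<Union>\<T> \<Longrightarrow> z \<in> \<Union>\<T> \<Longrightarrow> d x z \<le> d x y + d y z"
  shows "\<exists>C\<ge>0. \<forall>x\<in>\<Union>\<T>. \<forall>y\<in>\<Union>\<T>. d x y \<le> C * dist x y"
proof -
  have "\<exists>L\<ge>0. \<forall>x\<in>S. \<forall>y\<in>S. d x y \<le> L * dist x y" if S: "S \<in> \<T>" for S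
  proof -
    obtain L where L: "\<forall>x\<in>S. \<forall>y\<in>S. d x y \<le> L * dist x y"
      using local_bound[OF S] by blast
    have "d x y \<le> max 0 L * dist x y" if "x \<in> S" "y \<in> S" for x y
    proof -
      have "d x y \<le> L * dist x y"
        using L that by blast
      also have "\<dots> \<le> max 0 L * dist x y"
        by (intro mult_right_mono) auto
      finally show ?thesis .
    qed
    thus ?thesis
      by (intro exI[of _ "max 0 L"]) auto
  qed
  then obtain L where L0: "\<And>S. S \<in> \<T> \<Longrightarrow> L S \<ge> 0"
    and L: "\<And>S x y. S \<in> \<T> \<Longrightarrow> x \<in> S \<Longrightarrow> y \<in> S \<Longrightarrow> d x y \<le> L S * dist x y"
    by metis
  have "\<exists>C\<ge>0. \<forall>x\<in>S. \<forall>y\<in>T. d x y \<le> C * dist x y" if ST: "S \<in> \<T>" "T \<in> \<T>" for S T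
  proof (cases "S \<inter> T = {}")
    case False
    then obtain C where C: "C \<ge> 0" "\<forall>x\<in>S. \<forall>y\<in>T. \<exists>z\<in>S \<inter> T. dist x z \<le> C * dist x y"
      using polyhedra_linear_regularity[of S T] poly ST polytope_imp_polyhedron by blast
    have "d x y \<le> (L S * C + L T * (C + 1)) * dist x y" if xy: "x \<in> S" "y \<in> T" for x y
    proof -
      obtain z where z: "z \<in> S \<inter> T" "dist x z \<le> C * dist x y"
        using C(2) xy by blast
      have "dist z y \<le> (C + 1) * dist x y"
        using z(2) dist_triangle3[of z y x] by (simp add: algebra_simps)
      moreover have "d x y \<le> d x z + d z y"
        using z xy ST by (intro tri) auto
      moreover have "d x z \<le> L S * dist x z" "d z y \<le> L T * dist z y"
        using z xy ST by (auto intro: L)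
      moreover have "L S * dist x z \<le> L S * (C * dist x y)"
        using z L0 ST by (intro mult_left_mono) auto
      moreover have "L T * dist z y \<le> L T * ((C + 1) * dist x y)"
        using \<open>dist z y \<le> (C + 1) * dist x y\<close> L0 ST by (intro mult_left_mono) auto
      ultimately show ?thesis
        by (simp add: algebra_simps)
    qed
    thus ?thesis
      using C(1) L0 ST by (intro exI[of _ "L S * C + L T * (C + 1)"]) auto
  next
    case True
    show ?thesis
    proof (cases "S = {} \<or> T = {}")
      case False
      then obtain s t where st: "s \<in> S" "t \<in> T"
        by blast
      have cpt: "compact S" "compact T"
        using poly ST polytope_imp_compact by auto
      obtain r where r: "r > 0" "\<forall>x\<in>S. \<forall>y\<in>T. r \<le> dist x y"
        using separate_compact_closed[of S T] cpt True compact_imp_closed by blast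
      define D where "D = L S * diameter S + \<bar>d s t\<bar> + L T * diameter T"
      have "D \<ge> 0"
        using L0 ST cpt compact_imp_bounded
        by (auto simp: D_def intro!: add_nonneg_nonneg mult_nonneg_nonneg diameter_ge_0)
      have "d x y \<le> D / r * dist x y" if xy: "x \<in> S" "y \<in> T" for x y
      proof -
        have "x \<in> \<Union>\<T>" "y \<in> \<Union>\<T>" "s \<in> \<Union>\<T>" "t \<in> \<Union>\<T>"
          using xy st ST by blast+
        hence "d x y \<le> d x s + (d s t + d t y)"
          using tri[of x s y] tri[of s t y] by linarith
        also have "d x s \<le> L S * dist x s"
          using L xy st ST by blast
        also have "\<dots> \<le> L S * diameter S"
          using xy st ST L0 cpt by (intro mult_left_mono diameter_bounded_bound) (auto simp: compact_imp_bounded)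
        also have "d t y \<le> L T * dist t y"
          using L xy st ST by blast
        also have "\<dots> \<le> L T * diameter T"
          using xy st ST L0 cpt by (intro mult_left_mono diameter_bounded_bound) (auto simp: compact_imp_bounded)
        finally have "d x y \<le> D"
          unfolding D_def by linarith
        also have "D = D / r * r"
          using r by simp
        also have "\<dots> \<le> D / r * dist x y"
          using r \<open>D \<ge> 0\<close> xy by (intro mult_left_mono) auto
        finally show ?thesis .
      qed
      thus ?thesis
        using r \<open>D \<ge> 0\<close> by (intro exI[of _ "D / r"]) auto
    qed (auto intro: exI[of _ 0])
  qed
  then obtain C where C0: "\<And>S T. S \<in> \<T> \<Longrightarrow> T \<in> \<T> \<Longrightarrow> C S T \<ge> 0"
    and C: "\<And>S T x y. S \<in> \<T> \<Longrightarrow> T \<in> \<T> \<Longrightarrow> x \<in> S \<Longrightarrow> y \<in> T \<Longrightarrow> d x y \<le> C S T * dist x y"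
    by metis
  define M where "M = (\<Sum>(S,T)\<in>\<T> \<times> \<T>. C S T)"
  have "d x y \<le> M * dist x y" if xy: "x \<in> \<Union>\<T>" "y \<in> \<Union>\<T>" for x y
  proof -
    obtain S T where ST: "S \<in> \<T>" "T \<in> \<T>" "x \<in> S" "y \<in> T"
      using xy by blast
    have "(case (S, T) of (S, T) \<Rightarrow> C S T) \<le> M"
      unfolding M_def using ST fin C0 by (intro member_le_sum) auto
    hence "C S T * dist x y \<le> M * dist x y"
      by (intro mult_right_mono) auto
    thus ?thesis
      using C[OF ST] by linarith
  qed
  moreover have "M \<ge> 0"
    unfolding M_def using C0 by (intro sum_nonneg) auto
  ultimately show ?thesis
    by blast
qed

section \<open>Injective piecewise linear maps are bilipschitz\<close>

lemma affine_injective_lower_bound: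
  fixes f :: "'a::euclidean_space \<Rightarrow> 'b::euclidean_space"
  assumes "convex S" "inj_on f S" "linear L" "\<And>x. x \<in> S \<Longrightarrow> f x = L x + c"
  shows "\<exists>B. \<forall>x\<in>S. \<forall>y\<in>S. dist x y \<le> B * dist (f x) (f y)"
proof (cases "S = {}")
  case False
  then obtain p where p: "p \<in> rel_interior S"
    using rel_interior_eq_empty \<open>convex S\<close> by blast
  then obtain e where e: "p \<in> S" "e > 0" "cball p e \<inter> affine hull S \<subseteq> S"
    by (auto simp: mem_rel_interior_cball)
  define W where "W = (\<lambda>x. x - p) ` (affine hull S)"
  have W: "subspace W"
    unfolding W_def using e(1) by (intro affine_diffs_subspace_subtract) (auto intro: hull_inc)
  have ker: "v = 0" if "v \<in> W" "L v = 0" for v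
  proof (rule ccontr)
    assume "v \<noteq> 0"
    \<comment> \<open>Scaled down, \<open>v\<close> leads from the relative interior point \<open>p\<close> to another point of \<open>S\<close>.\<close>
    define w where "w = (e / norm v) *\<^sub>R v"
    have "w \<in> W"
      unfolding w_def using W that(1) by (rule subspace_scale)
    hence "p + w \<in> affine hull S"
      by (auto simp: W_def)
    moreover have "p + w \<in> cball p e"
      using \<open>v \<noteq> 0\<close> e(2) by (simp add: w_def dist_norm)
    ultimately have "p + w \<in> S"
      using e(3) by blast
    moreover have "f (p + w) = f p"
      using assms(3,4) \<open>p + w \<in> S\<close> e(1) that(2) by (simp add: w_def linear_add linear_scale)
    ultimately have "p + w = p"
      using inj_onD[OF assms(2), of "p + w" p] e(1) by blast
    thus False
      using \<open>v \<noteq> 0\<close> e(2) by (simp add: w_def)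
  qed
  have "\<exists>b>0. \<forall>x\<in>W. norm (L x) \<ge> b * norm x"
    using W ker assms(3)
    by (intro injective_imp_isometric closed_subspace) (auto simp: linear_conv_bounded_linear)
  then obtain b where b: "b > 0" "\<And>x. x \<in> W \<Longrightarrow> norm (L x) \<ge> b * norm x"
    by blast
  have "dist x y \<le> (1 / b) * dist (f x) (f y)" if xy: "x \<in> S" "y \<in> S" for x y
  proof -
    have "x - p \<in> W" "y - p \<in> W"
      using xy by (auto simp: W_def intro: hull_inc)
    hence "x - y \<in> W"
      using subspace_diff[OF W, of "x - p" "y - p"] by simp
    hence "b * norm (x - y) \<le> norm (L (x - y))"
      by (rule b)
    also have "L (x - y) = f x - f y"
      using xy assms(3,4) by (simp add: linear_diff)
    finally show ?thesis
      using b(1) by (simp add: dist_norm field_simps)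
  qed
  thus ?thesis
    by blast
qed auto

definition bilipschitz_on :: "'a::metric_space set \<Rightarrow> ('a \<Rightarrow> 'b::metric_space) \<Rightarrow> bool" where
  "bilipschitz_on X f \<longleftrightarrow>
     (\<exists>C>0. \<forall>x\<in>X. \<forall>y\<in>X. dist (f x) (f y) \<le> C * dist x y \<and> dist x y \<le> C * dist (f x) (f y))"

lemma bilipschitz_onI:
  assumes "\<And>x y. x \<in> X \<Longrightarrow> y \<in> X \<Longrightarrow> dist (f x) (f y) \<le> A * dist x y"
    and "\<And>x y. x \<in> X \<Longrightarrow> y \<in> X \<Longrightarrow> dist x y \<le> B * dist (f x) (f y)"
  shows "bilipschitz_on X f"
proof -
  define C where "C = max 1 (max A B)"
  have "dist (f x) (f y) \<le> C * dist x y" "dist x y \<le> C * dist (f x) (f y)"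
    if "x \<in> X" "y \<in> X" for x y
  proof -
    have "A * dist x y \<le> C * dist x y" "B * dist (f x) (f y) \<le> C * dist (f x) (f y)"
      by (intro mult_right_mono; simp add: C_def)+
    thus "dist (f x) (f y) \<le> C * dist x y" "dist x y \<le> C * dist (f x) (f y)"
      using assms[OF that] by linarith+
  qed
  moreover have "C > 0"
    by (simp add: C_def)
  ultimately show ?thesis
    unfolding bilipschitz_on_def by blast
qed

lemma bilipschitz_on_cong:
  assumes "\<And>x. x \<in> X \<Longrightarrow> f x = h x"
  shows "bilipschitz_on X f \<longleftrightarrow> bilipschitz_on X h"
  unfolding bilipschitz_on_def by (intro ex_cong1 conj_cong ball_cong refl) (simp_all only: assms)

lemma simplicial_complex_finite_polytopes:
  assumes "simplicial_complex T"
  shows "finite T" "\<And>S. S \<in> T \<Longrightarrow> polytope S"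
  using assms by (auto simp: simplicial_complex_def dest: simplex_imp_polytope)

text \<open>
  Both directions are instances of the comparison principle: the upper bound on the pieces \<open>S\<close> with
  the pulled-back distance \<open>dist (f x) (f y)\<close>, the lower bound on the polytopes \<open>f ` S\<close> with the
  distance pulled back along the inverse of \<open>f\<close>.
\<close>

lemma injective_pl_map_bilipschitz:
  fixes f :: "'a::euclidean_space \<Rightarrow> 'b::euclidean_space"
  assumes "pl_map K f" "inj_on f (\<Union>K)"
  shows "bilipschitz_on (\<Union>K) f"
proof -
  obtain T where T: "simplicial_complex T" "\<Union>T = \<Union>K"
    and aff: "\<forall>S\<in>T. \<exists>L c. linear L \<and> (\<forall>x\<in>S. f x = L x + c)"
    using assms(1) unfolding pl_map_def by (elim exE conjE)
  note fin = simplicial_complex_finite_polytopes(1)[OF T(1)]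
  note poly = simplicial_complex_finite_polytopes(2)[OF T(1)]
  have inj: "inj_on f (\<Union>T)"
    using assms(2) T(2) by simp
  define f' where "f' = the_inv_into (\<Union>T) f"
  have f': "f' (f x) = x" if "x \<in> \<Union>T" for x
    unfolding f'_def using inj that by (rule the_inv_into_f_f)
  have upper: "\<exists>C\<ge>0. \<forall>x\<in>\<Union>T. \<forall>y\<in>\<Union>T. dist (f x) (f y) \<le> C * dist x y"
  proof (rule pseudometric_le_dist_on_polytopes[OF fin poly])
    fix S assume S: "S \<in> T"
    obtain L c where L: "linear L" "\<forall>x\<in>S. f x = L x + c"
      using bspec[OF aff S] by (elim exE conjE)
    obtain B where B: "\<And>v. norm (L v) \<le> B * norm v"
      using linear_bounded[OF L(1)] by blast
    have "dist (f x) (f y) \<le> B * dist x y" if "x \<in> S" "y \<in> S" for x y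
      using B[of "x - y"] L that by (simp add: dist_norm linear_diff)
    thus "\<exists>L. \<forall>x\<in>S. \<forall>y\<in>S. dist (f x) (f y) \<le> L * dist x y"
      by blast
  qed (assumption, rule dist_triangle)
  have "\<exists>C\<ge>0. \<forall>u\<in>\<Union>((`) f ` T). \<forall>v\<in>\<Union>((`) f ` T). dist (f' u) (f' v) \<le> C * dist u v"
  proof (rule pseudometric_le_dist_on_polytopes)
    fix P assume "P \<in> (`) f ` T"
    then obtain S where S: "S \<in> T" "P = f ` S"
      by blast
    obtain L c where L: "linear L" "\<forall>x\<in>S. f x = L x + c"
      using bspec[OF aff S(1)] by (elim exE conjE)
    have "f ` S = (+) c ` (L ` S)"
      unfolding image_image using L(2) by (intro image_cong) (simp_all add: add.commute)
    moreover have "polytope ((+) c ` (L ` S))"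
      using poly[OF S(1)] L(1) by (simp only: polytope_translation_eq polytope_linear_image)
    ultimately show "polytope P"
      by (simp only: S(2))
    have "inj_on f S"
      using inj by (rule inj_on_subset) (use S(1) in blast)
    then obtain B where B: "\<forall>x\<in>S. \<forall>y\<in>S. dist x y \<le> B * dist (f x) (f y)"
      using affine_injective_lower_bound[OF polytope_imp_convex[OF poly[OF S(1)]] _ L(1), of f c] L(2)
      by blast
    have "f' (f x) = x" if "x \<in> S" for x
      by (rule f') (use S(1) that in blast)
    with B have "\<forall>u\<in>P. \<forall>v\<in>P. dist (f' u) (f' v) \<le> B * dist u v"
      unfolding S(2) by simp
    thus "\<exists>L. \<forall>u\<in>P. \<forall>v\<in>P. dist (f' u) (f' v) \<le> L * dist u v"
      by blast
  qed (rule finite_imageI[OF fin], rule dist_triangle)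
  then obtain C where C: "\<forall>u\<in>\<Union>((`) f ` T). \<forall>v\<in>\<Union>((`) f ` T). dist (f' u) (f' v) \<le> C * dist u v"
    by (elim exE conjE)
  have lower: "dist x y \<le> C * dist (f x) (f y)" if "x \<in> \<Union>T" "y \<in> \<Union>T" for x y
  proof -
    have "f x \<in> \<Union>((`) f ` T)" "f y \<in> \<Union>((`) f ` T)"
      using that by blast+
    hence "dist (f' (f x)) (f' (f y)) \<le> C * dist (f x) (f y)"
      by (rule C[rule_format])
    thus ?thesis
      using f' that by simp
  qed
  obtain A where A: "\<forall>x\<in>\<Union>T. \<forall>y\<in>\<Union>T. dist (f x) (f y) \<le> A * dist x y"
    using upper by (elim exE conjE)
  have "bilipschitz_on (\<Union>T) f"
    using A[rule_format] lower by (rule bilipschitz_onI)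
  thus ?thesis
    by (simp add: T(2))
qed

text \<open>
  Radial projection of the boundary of a convex body around the origin to the sphere is bilipschitz.
  If \<open>r\<close> is the radius of a ball around the origin inside \<open>P\<close> and \<open>v\<close> a boundary point that is
  closer to the origin than another one \<open>u\<close>, then \<open>v\<close> must not lie in the interior of the convex hull
  of \<open>u\<close> and that ball; this bounds \<open>norm u - norm v\<close> by the distance between the two directions.
\<close>

lemma radial_distance_le:
  fixes P :: "'a::euclidean_space set"
  assumes "convex P" "ball 0 r \<subseteq> interior P"
    and "u \<in> frontier P" "v \<in> frontier P" "norm u \<le> M" "norm v \<le> M" "r > 0" "norm v \<le> norm u"
  shows "norm u - norm v \<le> M\<^sup>2 / r * dist (sgn u) (sgn v)"
proof (cases "norm v = norm u")
  case False
  define a b where "a = norm u" and "b = norm v"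
  have "b < a"
    using False assms(8) by (simp add: a_def b_def)
  have "v \<notin> interior P"
    using assms(4) by (simp add: frontier_def)
  have "0 \<in> interior P"
    using assms(2,7) by (meson centre_in_ball subsetD)
  hence "v \<noteq> 0"
    using \<open>v \<notin> interior P\<close> by blast
  hence "b > 0"
    by (simp add: b_def)
  have "u \<noteq> 0"
    using \<open>b > 0\<close> \<open>b < a\<close> by (auto simp: a_def b_def)
  with \<open>v \<noteq> 0\<close> have u: "u = a *\<^sub>R sgn u" and v: "v = b *\<^sub>R sgn v"
    by (simp_all add: a_def b_def sgn_div_norm)
  define e where "e = 1 - b / a"
  have e: "0 < e" "e \<le> 1"
    using \<open>b > 0\<close> \<open>b < a\<close> by (auto simp: e_def)
  define w where "w = (b / e) *\<^sub>R (sgn v - sgn u)"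
  have "e *\<^sub>R w = b *\<^sub>R sgn v - b *\<^sub>R sgn u"
    using e by (simp add: w_def scaleR_diff_right)
  moreover have "(1 - e) *\<^sub>R u = b *\<^sub>R sgn u"
    using \<open>b > 0\<close> \<open>b < a\<close> by (subst u) (simp add: e_def)
  moreover have "u - e *\<^sub>R (u - w) = (1 - e) *\<^sub>R u + e *\<^sub>R w"
    by (simp add: algebra_simps)
  ultimately have "u - e *\<^sub>R (u - w) = v"
    using v by simp
  moreover have "u \<in> closure P"
    using assms(3) by (simp add: frontier_def)
  ultimately have "w \<notin> interior P"
    using mem_interior_closure_convex_shrink[of P w u e] assms(1) e \<open>v \<notin> interior P\<close> by auto
  hence "w \<notin> ball 0 r"
    using assms(2) by blast
  hence "r \<le> norm w"
    by simp
  also have "norm w = b / e * dist (sgn u) (sgn v)"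
    using e \<open>b > 0\<close> by (simp add: w_def dist_norm norm_minus_commute)
  finally have "r * e \<le> b * dist (sgn u) (sgn v)"
    using e by (simp add: field_simps)
  hence "r * (a - b) \<le> a * b * dist (sgn u) (sgn v)"
    using \<open>b > 0\<close> \<open>b < a\<close> by (simp add: e_def field_simps)
  also have "\<dots> \<le> M * M * dist (sgn u) (sgn v)"
    using assms(5,6) order_trans[OF norm_ge_zero assms(5)]
    by (intro mult_right_mono mult_mono) (auto simp: a_def b_def)
  finally show ?thesis
    using assms(7) by (simp add: a_def b_def field_simps power2_eq_square)
qed (use assms(7) in auto)

lemma sgn_bilipschitz_on_frontier:
  fixes P :: "'a::euclidean_space set"
  assumes "compact P" "convex P" "0 \<in> interior P"
  shows "bilipschitz_on (frontier P) sgn"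
proof -
  obtain r where r: "r > 0" "ball 0 r \<subseteq> interior P"
    using assms(3) open_contains_ball[of "interior P"] by auto
  obtain M where M: "\<And>x. x \<in> P \<Longrightarrow> norm x \<le> M"
    using compact_imp_bounded[OF assms(1)] unfolding bounded_iff by blast
  have sub: "frontier P \<subseteq> P"
    using assms(1) by (simp add: compact_imp_closed frontier_subset_closed)
  have ge: "r \<le> norm u" if "u \<in> frontier P" for u
  proof -
    have "u \<notin> ball 0 r"
      using that r(2) by (auto simp: frontier_def)
    thus ?thesis
      by simp
  qed
  have sgn: "norm x *\<^sub>R sgn x = x" for x :: 'a
    by (cases "x = 0") (simp_all add: sgn_div_norm)
  have key: "dist (sgn u) (sgn v) \<le> 2 / r * dist u v \<and> dist u v \<le> (M\<^sup>2 / r + M) * dist (sgn u) (sgn v)"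
    if uv: "u \<in> frontier P" "v \<in> frontier P" and le: "norm v \<le> norm u" for u v
  proof
    have "norm v *\<^sub>R (sgn u - sgn v) = (u - v) - (norm u - norm v) *\<^sub>R sgn u"
      by (simp add: algebra_simps sgn)
    hence "norm v * dist (sgn u) (sgn v) = norm ((u - v) - (norm u - norm v) *\<^sub>R sgn u)"
      by (metis abs_norm_cancel dist_norm norm_scaleR)
    also have "\<dots> \<le> norm (u - v) + \<bar>norm u - norm v\<bar> * norm (sgn u)"
      by (metis norm_scaleR norm_triangle_ineq4)
    also have "\<dots> \<le> norm (u - v) + \<bar>norm u - norm v\<bar>"
      by (simp add: norm_sgn)
    also have "\<dots> \<le> 2 * dist u v"
      using norm_triangle_ineq3[of u v] by (simp add: dist_norm)
    finally have "norm v * dist (sgn u) (sgn v) \<le> 2 * dist u v" .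
    moreover have "r * dist (sgn u) (sgn v) \<le> norm v * dist (sgn u) (sgn v)"
      using ge[OF uv(2)] by (intro mult_right_mono) auto
    ultimately show "dist (sgn u) (sgn v) \<le> 2 / r * dist u v"
      using r(1) by (simp add: field_simps)
  next
    have "u - v = (norm u - norm v) *\<^sub>R sgn u + norm v *\<^sub>R (sgn u - sgn v)"
      by (simp add: algebra_simps sgn)
    hence "dist u v \<le> \<bar>norm u - norm v\<bar> * norm (sgn u) + norm v * dist (sgn u) (sgn v)"
      by (metis abs_norm_cancel dist_norm norm_scaleR norm_triangle_ineq)
    also have "\<bar>norm u - norm v\<bar> * norm (sgn u) \<le> norm u - norm v"
      using le by (cases "u = 0") (simp_all add: norm_sgn)
    also have "norm u - norm v \<le> M\<^sup>2 / r * dist (sgn u) (sgn v)"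
      using r uv le M sub assms(2) by (intro radial_distance_le) auto
    also have "norm v * dist (sgn u) (sgn v) \<le> M * dist (sgn u) (sgn v)"
      using M sub uv by (intro mult_right_mono) auto
    finally show "dist u v \<le> (M\<^sup>2 / r + M) * dist (sgn u) (sgn v)"
      by (simp add: algebra_simps)
  qed
  have "dist (sgn u) (sgn v) \<le> 2 / r * dist u v \<and> dist u v \<le> (M\<^sup>2 / r + M) * dist (sgn u) (sgn v)"
    if "u \<in> frontier P" "v \<in> frontier P" for u v
    using key[of u v] key[of v u] that by (cases "norm v \<le> norm u") (auto simp: dist_commute)
  thus ?thesis
    by (intro bilipschitz_onI[of _ _ "2 / r" "M\<^sup>2 / r + M"]) auto
qed

lemma bilipschitz_on_compose:
  assumes "bilipschitz_on X f" "bilipschitz_on Y h" "f ` X \<subseteq> Y"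
  shows "bilipschitz_on X (\<lambda>x. h (f x))"
proof -
  obtain A where A: "A > 0"
    "\<forall>x\<in>X. \<forall>y\<in>X. dist (f x) (f y) \<le> A * dist x y \<and> dist x y \<le> A * dist (f x) (f y)"
    using assms(1) unfolding bilipschitz_on_def by (elim exE conjE)
  obtain B where B: "B > 0"
    "\<forall>x\<in>Y. \<forall>y\<in>Y. dist (h x) (h y) \<le> B * dist x y \<and> dist x y \<le> B * dist (h x) (h y)"
    using assms(2) unfolding bilipschitz_on_def by (elim exE conjE)
  show ?thesis
  proof (rule bilipschitz_onI)
    fix x y assume xy: "x \<in> X" "y \<in> X"
    have f: "dist (f x) (f y) \<le> A * dist x y" "dist x y \<le> A * dist (f x) (f y)"
      using A(2) xy by simp_all
    have h: "dist (h (f x)) (h (f y)) \<le> B * dist (f x) (f y)" "dist (f x) (f y) \<le> B * dist (h (f x)) (h (f y))"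
      using B(2) xy assms(3) by (simp_all add: image_subset_iff)
    show "dist (h (f x)) (h (f y)) \<le> (B * A) * dist x y"
      using order_trans[OF h(1) mult_left_mono[OF f(1), of B]] B(1) by (simp add: mult.assoc)
    show "dist x y \<le> (A * B) * dist (h (f x)) (h (f y))"
      using order_trans[OF f(2) mult_left_mono[OF h(2), of A]] A(1) by (simp add: mult.assoc)
  qed
qed

lemma embedding_map_imp_inj_on:
  "embedding_map (top_of_set X) euclidean f \<Longrightarrow> inj_on f X"
  unfolding embedding_map_def by (drule homeomorphic_imp_injective_map) simp

lemma pl_embedding_imp_bilipschitz:
  assumes "pl_embedding K f"
  shows "inj_on f (\<Union>K)" "bilipschitz_on (\<Union>K) f"
proof -
  show "inj_on f (\<Union>K)"
    using assms by (simp add: pl_embedding_def embedding_map_imp_inj_on)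
  thus "bilipschitz_on (\<Union>K) f"
    using assms by (intro injective_pl_map_bilipschitz) (simp_all add: pl_embedding_def)
qed

lemma pl_embedding_sphere_imp_bilipschitz:
  assumes "pl_embedding_sphere K g"
  shows "inj_on g (\<Union>K)" "bilipschitz_on (\<Union>K) g"
proof -
  show inj: "inj_on g (\<Union>K)"
    using assms by (simp add: pl_embedding_sphere_def embedding_map_imp_inj_on)
  obtain P k where P: "polytope P" "0 \<in> interior P" and k: "pl_map K k" "k ` \<Union>K \<subseteq> frontier P"
    and g: "\<forall>x\<in>\<Union>K. g x = sgn (k x)"
    using assms unfolding pl_embedding_sphere_def pl_map_sphere_def by (elim exE conjE)
  have "inj_on k (\<Union>K)"
  proof (rule inj_onI)
    fix x y assume xy: "x \<in> \<Union>K" "y \<in> \<Union>K" "k x = k y"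
    have "g x = sgn (k x)" "g y = sgn (k y)"
      using bspec[OF g xy(1)] bspec[OF g xy(2)] by simp_all
    thus "x = y"
      using inj_onD[OF inj _ xy(1,2)] xy(3) by simp
  qed
  hence "bilipschitz_on (\<Union>K) k"
    using k(1) by (intro injective_pl_map_bilipschitz)
  hence "bilipschitz_on (\<Union>K) (\<lambda>x. sgn (k x))"
    using sgn_bilipschitz_on_frontier[OF polytope_imp_compact polytope_imp_convex, OF P(1) P(1) P(2)] k(2)
    by (rule bilipschitz_on_compose)
  thus "bilipschitz_on (\<Union>K) g"
    using bilipschitz_on_cong[of "\<Union>K" g "\<lambda>x. sgn (k x)"] bspec[OF g] by simp
qed

section \<open>Path distances in connected polyhedra\<close>

lemma path_length_compose_le:
  assumes "L \<ge> 0" and "path_image \<gamma> \<subseteq> S"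
    and "\<And>u v. u \<in> S \<Longrightarrow> v \<in> S \<Longrightarrow> dist (\<phi> u) (\<phi> v) \<le> L * dist u v"
  shows "path_length (\<phi> \<circ> \<gamma>) \<le> ennreal L * path_length \<gamma>"
proof (rule path_length_leI)
  fix N :: nat and t :: "nat \<Rightarrow> real"
  assume t: "incseq t" "range t \<subseteq> {0..1}"
  have S: "\<gamma> (t i) \<in> S" for i
    using t(2) assms(2) by (auto simp: path_image_def)
  have "(\<Sum>i<N. dist ((\<phi> \<circ> \<gamma>) (t i)) ((\<phi> \<circ> \<gamma>) (t (Suc i)))) \<le> (\<Sum>i<N. L * dist (\<gamma> (t i)) (\<gamma> (t (Suc i))))"
    unfolding o_def by (intro sum_mono assms(3) S)
  hence "ennreal (\<Sum>i<N. dist ((\<phi> \<circ> \<gamma>) (t i)) ((\<phi> \<circ> \<gamma>) (t (Suc i))))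
           \<le> ennreal (L * (\<Sum>i<N. dist (\<gamma> (t i)) (\<gamma> (t (Suc i)))))"
    by (intro ennreal_leI) (simp only: sum_distrib_left)
  also have "\<dots> = ennreal L * ennreal (\<Sum>i<N. dist (\<gamma> (t i)) (\<gamma> (t (Suc i))))"
    using assms(1) by (intro ennreal_mult sum_nonneg) auto
  also have "\<dots> \<le> ennreal L * path_length \<gamma>"
    by (intro mult_left_mono path_length_ge_sum t) auto
  finally show "ennreal (\<Sum>i<N. dist ((\<phi> \<circ> \<gamma>) (t i)) ((\<phi> \<circ> \<gamma>) (t (Suc i)))) \<le> ennreal L * path_length \<gamma>" .
qed

lemma path_dist_Lipschitz_image:
  assumes "L \<ge> 0" "B \<ge> 0" and "\<phi> ` S \<subseteq> T"
    and lip: "\<And>u v. u \<in> S \<Longrightarrow> v \<in> S \<Longrightarrow> dist (\<phi> u) (\<phi> v) \<le> L * dist u v"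
    and less: "path_dist S x y < ennreal B"
  shows "path_dist T (\<phi> x) (\<phi> y) \<le> ennreal (L * B)"
proof -
  obtain \<gamma> where g: "path \<gamma>" "path_image \<gamma> \<subseteq> S" "pathstart \<gamma> = x" "pathfinish \<gamma> = y"
    "path_length \<gamma> < ennreal B"
    using less unfolding path_dist_less_iff by (elim exE conjE)
  have "continuous_on S \<phi>"
    using lip assms(1) by (intro lipschitz_on_continuous_on[of L] lipschitz_onI)
  hence "path (\<phi> \<circ> \<gamma>)"
    by (rule path_continuous_image[OF g(1) continuous_on_subset[OF _ g(2)]])
  moreover have "path_image (\<phi> \<circ> \<gamma>) \<subseteq> T"
    using g(2) assms(3) by (auto simp: path_image_compose)
  moreover have "pathstart (\<phi> \<circ> \<gamma>) = \<phi> x" "pathfinish (\<phi> \<circ> \<gamma>) = \<phi> y"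
    using g(3,4) by (simp_all add: pathstart_compose pathfinish_compose)
  ultimately have "path_dist T (\<phi> x) (\<phi> y) \<le> path_length (\<phi> \<circ> \<gamma>)"
    unfolding path_dist_def by (intro INF_lower) simp
  also have "\<dots> \<le> ennreal L * path_length \<gamma>"
    using assms(1) g(2) lip by (rule path_length_compose_le)
  also have "\<dots> \<le> ennreal L * ennreal B"
    using g(5) by (intro mult_left_mono) auto
  also have "\<dots> = ennreal (L * B)"
    using assms(1,2) by (simp add: ennreal_mult)
  finally show ?thesis .
qed

lemma path_dist_segment_le:
  fixes x y :: "'a::real_normed_vector"
  assumes "closed_segment x y \<subseteq> S"
  shows "path_dist S x y \<le> ennreal (dist x y)"
proof -
  have "path_dist S x y \<le> path_length (linepath x y)"
    unfolding path_dist_def using assms by (intro INF_lower) simp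
  also have "\<dots> \<le> ennreal (dist x y)"
  proof (rule path_length_leI)
    fix N :: nat and t :: "nat \<Rightarrow> real"
    assume t: "incseq t" "range t \<subseteq> {0..1}"
    have "dist (linepath x y (t i)) (linepath x y (t (Suc i))) = (t (Suc i) - t i) * dist x y" for i
    proof -
      have "linepath x y (t (Suc i)) - linepath x y (t i) = (t (Suc i) - t i) *\<^sub>R (y - x)"
        by (simp add: linepath_def algebra_simps)
      moreover have "t i \<le> t (Suc i)"
        using t(1) by (simp add: incseq_SucD)
      ultimately show ?thesis
        by (subst dist_commute) (simp add: dist_norm norm_minus_commute[of y x])
    qed
    hence "(\<Sum>i<N. dist (linepath x y (t i)) (linepath x y (t (Suc i)))) = (t N - t 0) * dist x y"
      by (simp add: sum_lessThan_telescope flip: sum_distrib_right)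
    also have "\<dots> \<le> 1 * dist x y"
    proof (intro mult_right_mono)
      have "t N \<in> {0..1}" "t 0 \<in> {0..1}"
        using t(2) by blast+
      thus "t N - t 0 \<le> 1"
        by simp
    qed simp
    finally show "ennreal (\<Sum>i<N. dist (linepath x y (t i)) (linepath x y (t (Suc i)))) \<le> ennreal (dist x y)"
      by (simp add: ennreal_leI)
  qed
  finally show ?thesis .
qed

lemma path_dist_commute: "path_dist S x y = path_dist S y x"
  by (intro antisym path_dist_le_commute)

text \<open>
  The points at finite path distance from \<open>x\<close> form a union of pieces, and so do the remaining ones:
  by finiteness both sets are closed, so connectedness leaves no room for the second.
\<close>

lemma connected_polytope_union_rectifiably_connected:
  fixes \<T> :: "'a::euclidean_space set set"
  assumes "finite \<T>" and poly: "\<And>S. S \<in> \<T> \<Longrightarrow> polytope S" and "connected (\<Union>\<T>)"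
  shows "rectifiably_connected (\<Union>\<T>)"
proof -
  define X where "X = \<Union>\<T>"
  have fin_in_piece: "path_dist X y z < \<infinity>" if "S \<in> \<T>" "y \<in> S" "z \<in> S" for S y z
  proof -
    have "closed_segment y z \<subseteq> S"
      using polytope_imp_convex[OF poly[OF that(1)]] that(2,3) by (rule closed_segment_subset[rotated 2])
    hence "path_dist X y z \<le> ennreal (dist y z)"
      using that(1) by (intro path_dist_segment_le) (auto simp: X_def)
    also have "\<dots> < \<infinity>"
      by simp
    finally show ?thesis .
  qed
  have "path_dist X x y < \<infinity>" if xy: "x \<in> X" "y \<in> X" for x y
  proof (rule ccontr)
    assume infinite: "\<not> path_dist X x y < \<infinity>"
    define A where "A = {S\<in>\<T>. \<exists>z\<in>S. path_dist X x z < \<infinity>}"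
    have A: "path_dist X x z < \<infinity>" if "z \<in> \<Union>A" for z
    proof -
      obtain S u where S: "S \<in> \<T>" "z \<in> S" "u \<in> S" "path_dist X x u < \<infinity>"
        using \<open>z \<in> \<Union>A\<close> unfolding A_def by blast
      have "path_dist X x z \<le> path_dist X x u + path_dist X u z"
        by (rule path_dist_triangle)
      also have "\<dots> < \<infinity>"
        using S(4) fin_in_piece[OF S(1,3,2)] by simp
      finally show ?thesis .
    qed
    have clA: "closed (\<Union>A)" and clB: "closed (\<Union>(\<T> - A))"
      using assms(1) poly[THEN polytope_imp_closed] by (intro closed_Union; simp add: A_def)+
    have cover: "X \<subseteq> \<Union>A \<union> \<Union>(\<T> - A)"
      unfolding X_def by blast
    have "\<Union>A \<inter> \<Union>(\<T> - A) = {}"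
    proof -
      have "z \<notin> S" if "z \<in> \<Union>A" "S \<in> \<T> - A" for z S
        using A[OF that(1)] that(2) unfolding A_def by blast
      thus ?thesis
        by blast
    qed
    hence disj: "\<Union>A \<inter> \<Union>(\<T> - A) \<inter> X = {}"
      by simp
    have "x \<in> \<Union>A"
      using xy(1) fin_in_piece[of _ x x] unfolding A_def X_def by blast
    hence neA: "\<Union>A \<inter> X \<noteq> {}"
      using xy(1) by blast
    have "y \<notin> \<Union>A"
      using A infinite by blast
    hence neB: "\<Union>(\<T> - A) \<inter> X \<noteq> {}"
      using xy(2) cover by blast
    have "connected X"
      using assms(3) by (simp add: X_def)
    thus False
      using connected_closedD[OF _ disj cover clA clB] neA neB by simp
  qed
  thus ?thesis
    unfolding rectifiably_connected_def X_def by blast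
qed

text \<open>
  Inside one piece a segment realises the distance, so this is the comparison principle for the
  path metric; connectedness enters by making the path metric finite.
\<close>

lemma connected_polytope_union_quasiconvex:
  fixes \<T> :: "'a::euclidean_space set set"
  assumes "finite \<T>" and poly: "\<And>S. S \<in> \<T> \<Longrightarrow> polytope S" and "connected (\<Union>\<T>)"
  shows "\<exists>Q\<ge>0. \<forall>x\<in>\<Union>\<T>. \<forall>y\<in>\<Union>\<T>. path_dist (\<Union>\<T>) x y \<le> ennreal (Q * dist x y)"
proof -
  have rc: "rectifiably_connected (\<Union>\<T>)"
    using assms by (rule connected_polytope_union_rectifiably_connected)
  define d where "d x y = enn2real (path_dist (\<Union>\<T>) x y)" for x y
  have "\<exists>Q\<ge>0. \<forall>x\<in>\<Union>\<T>. \<forall>y\<in>\<Union>\<T>. d x y \<le> Q * dist x y"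
  proof (rule pseudometric_le_dist_on_polytopes[OF assms(1) poly])
    fix S assume S: "S \<in> \<T>"
    have "d x y \<le> 1 * dist x y" if "x \<in> S" "y \<in> S" for x y
    proof -
      have "closed_segment x y \<subseteq> S"
        using polytope_imp_convex[OF poly[OF S]] that by (rule closed_segment_subset[rotated 2])
      hence "path_dist (\<Union>\<T>) x y \<le> ennreal (dist x y)"
        using S by (intro path_dist_segment_le) auto
      thus ?thesis
        unfolding d_def by (simp add: enn2real_leI)
    qed
    thus "\<exists>L. \<forall>x\<in>S. \<forall>y\<in>S. d x y \<le> L * dist x y"
      by blast
  next
    fix x y z assume "x \<in> \<Union>\<T>" "y \<in> \<Union>\<T>" "z \<in> \<Union>\<T>"
    thus "d x z \<le> d x y + d y z"
      unfolding d_def by (rule Metric_space.triangle[OF Metric_space_path_dist[OF rc]])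
  qed
  then obtain Q where Q: "Q \<ge> 0" "\<forall>x\<in>\<Union>\<T>. \<forall>y\<in>\<Union>\<T>. d x y \<le> Q * dist x y"
    by (elim exE conjE)
  have "path_dist (\<Union>\<T>) x y \<le> ennreal (Q * dist x y)" if "x \<in> \<Union>\<T>" "y \<in> \<Union>\<T>" for x y
  proof -
    have "path_dist (\<Union>\<T>) x y < \<infinity>"
      using rc that unfolding rectifiably_connected_def by blast
    hence "path_dist (\<Union>\<T>) x y = ennreal (d x y)"
      unfolding d_def by (simp add: less_top)
    also have "\<dots> \<le> ennreal (Q * dist x y)"
      using Q(2) that by (intro ennreal_leI) blast
    finally show ?thesis .
  qed
  thus ?thesis
    using Q(1) by blast
qed

section \<open>A common coordinate system for all cones\<close>

definition cone_point :: "('a \<Rightarrow> 'b::real_vector) \<Rightarrow> 'a \<times> real \<Rightarrow> 'b" where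
  "cone_point G = (\<lambda>(x, h). h *\<^sub>R G x)"

text \<open>
  The model for the metric of a cone over \<open>X\<close>: to get from \<open>(x, h)\<close> to \<open>(y, k)\<close>, move at the lower
  of the two heights and then along a ray. It need not satisfy the triangle inequality, and refers
  neither to an embedding nor to the shape of the base.
\<close>

definition cone_gauge :: "'a::metric_space \<times> real \<Rightarrow> 'a \<times> real \<Rightarrow> real" where
  "cone_gauge = (\<lambda>(x, h) (y, k). \<bar>h - k\<bar> + min h k * dist x y)"

lemma cone_gauge_nonneg: "snd p \<ge> 0 \<Longrightarrow> snd q \<ge> 0 \<Longrightarrow> cone_gauge p q \<ge> 0"
  by (simp add: cone_gauge_def split_beta)

lemma cone_gauge_commute: "cone_gauge p q = cone_gauge q p"
  by (simp add: cone_gauge_def split_beta abs_minus_commute min.commute dist_commute)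

text \<open>
  A chart presents a metric on a cone, up to a constant factor, by the gauge on the coordinates
  \<open>D\<close>. All the maps to be shown bilipschitz are transition maps between two such charts with the
  same \<open>D\<close>, and so are their inverses.
\<close>

definition cone_chart :: "('a::metric_space \<times> real) set \<Rightarrow> ('a \<times> real \<Rightarrow> 'b) \<Rightarrow> 'b metric \<Rightarrow> bool" where
  "cone_chart D \<Phi> m \<longleftrightarrow> mspace m = \<Phi> ` D \<and>
     (\<exists>C. \<forall>p\<in>D. \<forall>q\<in>D. mdist m (\<Phi> p) (\<Phi> q) \<le> C * cone_gauge p q \<and>
                         cone_gauge p q \<le> C * mdist m (\<Phi> p) (\<Phi> q))"

lemma cone_chartI:
  assumes "mspace m = \<Phi> ` D" and "D \<subseteq> UNIV \<times> {0..}"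
    and "\<And>p q. p \<in> D \<Longrightarrow> q \<in> D \<Longrightarrow> mdist m (\<Phi> p) (\<Phi> q) \<le> A * cone_gauge p q"
    and "\<And>p q. p \<in> D \<Longrightarrow> q \<in> D \<Longrightarrow> cone_gauge p q \<le> B * mdist m (\<Phi> p) (\<Phi> q)"
  shows "cone_chart D \<Phi> m"
proof -
  have "mdist m (\<Phi> p) (\<Phi> q) \<le> max A B * cone_gauge p q \<and> cone_gauge p q \<le> max A B * mdist m (\<Phi> p) (\<Phi> q)"
    if "p \<in> D" "q \<in> D" for p q
  proof -
    have "cone_gauge p q \<ge> 0"
      using assms(2) that by (intro cone_gauge_nonneg) auto
    hence "A * cone_gauge p q \<le> max A B * cone_gauge p q"
          "B * mdist m (\<Phi> p) (\<Phi> q) \<le> max A B * mdist m (\<Phi> p) (\<Phi> q)"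
      by (intro mult_right_mono; simp)+
    thus ?thesis
      using assms(3,4)[OF that] by linarith
  qed
  thus ?thesis
    unfolding cone_chart_def using assms(1) by blast
qed

lemma cone_chart_transition_Lipschitz:
  assumes "cone_chart D \<Phi>1 m1" "cone_chart D \<Phi>2 m2" and "D \<subseteq> UNIV \<times> {0..}"
    and \<psi>: "\<And>p. p \<in> D \<Longrightarrow> \<psi> (\<Phi>1 p) = \<Phi>2 p"
  shows "Lipschitz_continuous_map m1 m2 \<psi>"
proof -
  obtain C1 where C1: "\<forall>p\<in>D. \<forall>q\<in>D. mdist m1 (\<Phi>1 p) (\<Phi>1 q) \<le> C1 * cone_gauge p q \<and>
                         cone_gauge p q \<le> C1 * mdist m1 (\<Phi>1 p) (\<Phi>1 q)"
    using assms(1) unfolding cone_chart_def by (elim exE conjE)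
  obtain C2 where C2: "\<forall>p\<in>D. \<forall>q\<in>D. mdist m2 (\<Phi>2 p) (\<Phi>2 q) \<le> C2 * cone_gauge p q \<and>
                         cone_gauge p q \<le> C2 * mdist m2 (\<Phi>2 p) (\<Phi>2 q)"
    using assms(2) unfolding cone_chart_def by (elim exE conjE)
  have ms: "mspace m1 = \<Phi>1 ` D" "mspace m2 = \<Phi>2 ` D"
    using assms(1,2) by (simp_all add: cone_chart_def)
  have "mdist m2 (\<psi> u) (\<psi> v) \<le> (\<bar>C2\<bar> * C1) * mdist m1 u v"
    if uv: "u \<in> mspace m1" "v \<in> mspace m1" for u v
  proof -
    obtain p q where pq: "p \<in> D" "q \<in> D" "u = \<Phi>1 p" "v = \<Phi>1 q"
      using uv unfolding ms by blast
    have "mdist m2 (\<psi> u) (\<psi> v) \<le> C2 * cone_gauge p q"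
      using C2 pq \<psi> by simp
    also have "\<dots> \<le> \<bar>C2\<bar> * cone_gauge p q"
      using assms(3) pq by (intro mult_right_mono cone_gauge_nonneg) auto
    also have "\<dots> \<le> \<bar>C2\<bar> * (C1 * mdist m1 u v)"
      using C1 pq by (intro mult_left_mono) auto
    finally show ?thesis
      by (simp add: mult.assoc)
  qed
  moreover have "\<psi> \<in> mspace m1 \<rightarrow> mspace m2"
    using \<psi> by (auto simp: ms)
  ultimately show ?thesis
    unfolding Lipschitz_continuous_map_def by (intro conjI exI[of _ "\<bar>C2\<bar> * C1"]) simp_all
qed

text \<open>
  Two charts identify the same coordinates, namely those at gauge zero from each other; hence a
  transition map exists.
\<close>

lemma cone_chart_transition_exists:
  assumes "cone_chart D \<Phi>1 m1" "cone_chart D \<Phi>2 m2" and D: "D \<subseteq> UNIV \<times> {0..}"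
  shows "\<exists>\<psi>. \<forall>p\<in>D. \<psi> (\<Phi>1 p) = \<Phi>2 p"
proof -
  have "\<Phi>2 p = \<Phi>2 q" if pq: "p \<in> D" "q \<in> D" and eq: "\<Phi>1 p = \<Phi>1 q" for p q
  proof -
    obtain C1 where C1: "cone_gauge p q \<le> C1 * mdist m1 (\<Phi>1 p) (\<Phi>1 q)"
      using assms(1) pq unfolding cone_chart_def by blast
    obtain C2 where C2: "mdist m2 (\<Phi>2 p) (\<Phi>2 q) \<le> C2 * cone_gauge p q"
      using assms(2) pq unfolding cone_chart_def by blast
    have in_space: "\<Phi>1 p \<in> mspace m1" "\<Phi>2 p \<in> mspace m2" "\<Phi>2 q \<in> mspace m2"
      using assms(1,2) pq by (simp_all add: cone_chart_def)
    have "cone_gauge p q \<le> 0"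
      using C1 Metric_space.mdist_zero[OF Metric_space_mspace_mdist in_space(1)] by (simp flip: eq)
    moreover have "cone_gauge p q \<ge> 0"
      using D pq by (intro cone_gauge_nonneg) auto
    ultimately have "mdist m2 (\<Phi>2 p) (\<Phi>2 q) \<le> 0"
      using C2 by simp
    hence "mdist m2 (\<Phi>2 p) (\<Phi>2 q) = 0"
      by (intro antisym) simp_all
    thus ?thesis
      using Metric_space.zero[OF Metric_space_mspace_mdist in_space(2,3)] by simp
  qed
  note wd = this
  have "\<Phi>2 (SOME q. q \<in> D \<and> \<Phi>1 q = \<Phi>1 p) = \<Phi>2 p" if "p \<in> D" for p
  proof (rule someI2[of _ p])
    show "p \<in> D \<and> \<Phi>1 p = \<Phi>1 p"
      using that by simp
    show "\<Phi>2 q = \<Phi>2 p" if "q \<in> D \<and> \<Phi>1 q = \<Phi>1 p" for q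
      using wd[of q p] \<open>p \<in> D\<close> that by blast
  qed
  thus ?thesis
    by (intro exI[of _ "\<lambda>y. \<Phi>2 (SOME q. q \<in> D \<and> \<Phi>1 q = y)"]) simp
qed

lemma cone_chart_transition_bilipschitz:
  assumes "cone_chart D \<Phi>1 m1" "cone_chart D \<Phi>2 m2" and "D \<subseteq> UNIV \<times> {0..}"
    and \<psi>: "\<And>p. p \<in> D \<Longrightarrow> \<psi> (\<Phi>1 p) = \<Phi>2 p"
  shows "bilipschitz_homeomorphism m1 m2 \<psi>"
proof -
  obtain \<theta> where \<theta>: "\<forall>p\<in>D. \<theta> (\<Phi>2 p) = \<Phi>1 p"
    using cone_chart_transition_exists[OF assms(2,1,3)] by (elim exE)
  have "Lipschitz_continuous_map m1 m2 \<psi>"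
    using assms by (rule cone_chart_transition_Lipschitz)
  moreover have "Lipschitz_continuous_map m2 m1 \<theta>"
    using assms(2,1,3) bspec[OF \<theta>] by (rule cone_chart_transition_Lipschitz)
  moreover have "\<forall>x\<in>mspace m1. \<theta> (\<psi> x) = x" "\<forall>y\<in>mspace m2. \<psi> (\<theta> y) = y"
    using assms(1,2) \<psi> bspec[OF \<theta>] by (simp_all add: cone_chart_def)
  ultimately show ?thesis
    unfolding bilipschitz_homeomorphism_def by (intro conjI exI[of _ \<theta>])
qed

definition charted_cone :: "('a::metric_space \<times> real) set \<Rightarrow> ('a \<times> real \<Rightarrow> 'b) \<Rightarrow> 'b::metric_space set \<Rightarrow> bool" where
  "charted_cone D \<Phi> S \<longleftrightarrow> rectifiably_connected S \<and> (\<forall>m\<in>cone_metrics S. cone_chart D \<Phi> m)"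

lemma charted_cones_bilipschitz:
  assumes "charted_cone D \<Phi>1 S" "charted_cone D \<Phi>2 T" "D \<subseteq> UNIV \<times> {0..}"
    and "\<And>p. p \<in> D \<Longrightarrow> \<psi> (\<Phi>1 p) = \<Phi>2 p"
  shows "bilipschitz_for_all_metrics S T \<psi>"
  unfolding bilipschitz_for_all_metrics_def
proof (intro ballI)
  fix m1 m2 assume "m1 \<in> cone_metrics S" "m2 \<in> cone_metrics T"
  hence "cone_chart D \<Phi>1 m1" "cone_chart D \<Phi>2 m2"
    using assms(1,2) by (simp_all add: charted_cone_def)
  thus "bilipschitz_homeomorphism m1 m2 \<psi>"
    using assms(3,4) by (rule cone_chart_transition_bilipschitz)
qed

lemma charted_cones_comparable:
  assumes "charted_cone D \<Phi>1 S" "charted_cone D \<Phi>2 T" "D \<subseteq> UNIV \<times> {0..}"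
    and "\<And>p. p \<in> D \<Longrightarrow> \<psi> (\<Phi>1 p) = \<Phi>2 p"
  shows "cones_comparable S T \<psi>"
proof -
  have "bilipschitz_for_all_metrics S T \<psi>"
    using assms by (rule charted_cones_bilipschitz)
  moreover have "bilipschitz_for_all_metrics S S id"
    using assms(1,1,3) by (rule charted_cones_bilipschitz) simp
  moreover have "bilipschitz_for_all_metrics T T id"
    using assms(2,2,3) by (rule charted_cones_bilipschitz) simp
  ultimately show ?thesis
    using assms(1,2) by (simp add: cones_comparable_def charted_cone_def)
qed

lemma charted_cones_same_bilipschitz_class:
  assumes "charted_cone D \<Phi>1 S" "charted_cone D \<Phi>2 T" "D \<subseteq> UNIV \<times> {0..}"
  shows "same_bilipschitz_class S T"
  unfolding same_bilipschitz_class_def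
proof (intro ballI)
  fix m1 m2 assume "m1 \<in> cone_metrics S" "m2 \<in> cone_metrics T"
  hence charts: "cone_chart D \<Phi>1 m1" "cone_chart D \<Phi>2 m2"
    using assms(1,2) by (simp_all add: charted_cone_def)
  obtain \<psi> where "\<forall>p\<in>D. \<psi> (\<Phi>1 p) = \<Phi>2 p"
    using cone_chart_transition_exists[OF charts assms(3)] by (elim exE)
  hence "bilipschitz_homeomorphism m1 m2 \<psi>"
    using charts assms(3) by (intro cone_chart_transition_bilipschitz[of D \<Phi>1 m1 \<Phi>2 m2]) simp_all
  thus "\<exists>\<phi>. bilipschitz_homeomorphism m1 m2 \<phi>"
    by (rule exI[of _ \<psi>])
qed

section \<open>Metrics on the cone over a bilipschitz embedding\<close>

text \<open>
  The chain of inequalities is \<open>gauge \<le> C * dist\<close>, \<open>dist \<le> path_dist\<close> and \<open>path_dist \<le> C' * gauge\<close>.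
  The last one uses a curve that follows the two legs of the gauge; its first leg is the image at
  height \<open>h\<close> of a short curve in \<open>X\<close>, and it stays at the heights between \<open>h\<close> and \<open>k\<close>, hence in the
  truncated cone. The assumption on the heights says that the two legs cannot cancel: height is
  recovered from the point of the cone by a nonexpanding function.
\<close>

lemma cone_over_bilipschitz_embedding_charted:
  fixes G :: "'a::metric_space \<Rightarrow> 'b::real_normed_vector"
  assumes R: "R \<ge> 0"
    and quasiconvex: "Q \<ge> 0" "\<And>x y. x \<in> X \<Longrightarrow> y \<in> X \<Longrightarrow> path_dist X x y \<le> ennreal (Q * dist x y)"
    and bilip: "bilipschitz_on X G"
    and bounded: "\<And>x. x \<in> X \<Longrightarrow> norm (G x) \<le> M"
    and height: "\<And>x y h k. x \<in> X \<Longrightarrow> y \<in> X \<Longrightarrow> h \<ge> 0 \<Longrightarrow> k \<ge> 0 \<Longrightarrow>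
                   \<bar>h - k\<bar> \<le> norm (h *\<^sub>R G x - k *\<^sub>R G y)"
  shows "charted_cone (X \<times> {R..}) (cone_point G) (cone_point G ` (X \<times> {R..}))"
proof -
  define D where "D = X \<times> {R..}"
  define S where "S = cone_point G ` D"
  obtain L where L: "L > 0"
    "\<forall>x\<in>X. \<forall>y\<in>X. dist (G x) (G y) \<le> L * dist x y \<and> dist x y \<le> L * dist (G x) (G y)"
    using bilip unfolding bilipschitz_on_def by (elim exE conjE)
  define A where "A = L * (Q + 1) + \<bar>M\<bar>"
  define B where "B = 1 + L * (1 + \<bar>M\<bar>)"
  have D: "D \<subseteq> UNIV \<times> {0..}"
    using R by (auto simp: D_def)
  \<comment> \<open>The absolute value matters when \<open>X\<close> is empty: then \<open>M\<close> may be negative.\<close>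
  have M: "norm (G x) \<le> \<bar>M\<bar>" if "x \<in> X" for x
    using bounded[OF that] by linarith
  have S: "h *\<^sub>R G x \<in> S" if "x \<in> X" "h \<ge> R" for x h
    unfolding S_def D_def cone_point_def using that by (intro image_eqI[of _ _ "(x, h)"]) simp_all

  have lower_ordered: "cone_gauge (x, h) (y, k) \<le> B * dist (cone_point G (x, h)) (cone_point G (y, k))"
    if xy: "x \<in> X" "y \<in> X" and hk: "0 \<le> h" "h \<le> k" for x y h k
  proof -
    define E where "E = norm (h *\<^sub>R G x - k *\<^sub>R G y)"
    have E: "k - h \<le> E"
      using height[OF xy, of h k] hk by (simp add: E_def)
    have "h *\<^sub>R (G x - G y) = (h *\<^sub>R G x - k *\<^sub>R G y) + (k - h) *\<^sub>R G y"
      by (simp add: algebra_simps)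
    hence "norm (h *\<^sub>R (G x - G y)) \<le> E + norm ((k - h) *\<^sub>R G y)"
      unfolding E_def by (simp only: norm_triangle_ineq)
    hence "h * dist (G x) (G y) \<le> E + (k - h) * norm (G y)"
      using hk by (simp add: dist_norm)
    also have "(k - h) * norm (G y) \<le> E * \<bar>M\<bar>"
      using E hk M[OF xy(2)] by (intro mult_mono) auto
    finally have *: "h * dist (G x) (G y) \<le> E * (1 + \<bar>M\<bar>)"
      by (simp add: algebra_simps)
    have "h * dist x y \<le> h * (L * dist (G x) (G y))"
      using L(2) xy hk by (intro mult_left_mono) simp_all
    also have "\<dots> = L * (h * dist (G x) (G y))"
      by simp
    also have "\<dots> \<le> L * (E * (1 + \<bar>M\<bar>))"
      using L(1) * by (intro mult_left_mono) simp_all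
    finally have "(k - h) + h * dist x y \<le> B * E"
      using E by (simp add: B_def algebra_simps)
    thus ?thesis
      using hk by (simp add: cone_gauge_def cone_point_def E_def dist_norm min_def)
  qed
  have lower: "cone_gauge p q \<le> B * dist (cone_point G p) (cone_point G q)" if pqD: "p \<in> D" "q \<in> D" for p q
  proof -
    obtain x h y k where pq: "p = (x, h)" "q = (y, k)" "x \<in> X" "y \<in> X" "h \<ge> 0" "k \<ge> 0"
      using pqD D by (cases p; cases q) (auto simp: D_def)
    show ?thesis
      unfolding pq(1,2) using lower_ordered[of x y h k] lower_ordered[of y x k h] pq(3-)
      by (cases "h \<le> k") (simp_all add: cone_gauge_commute[of "(x, h)"] dist_commute)
  qed

  have upper_ordered: "path_dist S (cone_point G (x, h)) (cone_point G (y, k)) \<le> ennreal (A * cone_gauge (x, h) (y, k))"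
    if xy: "x \<in> X" "y \<in> X" and hk: "R \<le> h" "h \<le> k" for x y h k
  proof -
    have h0: "h \<ge> 0"
      using R hk by simp
    have level: "path_dist S (h *\<^sub>R G x) (h *\<^sub>R G y) \<le> ennreal (h * L * ((Q + 1) * dist x y))"
    proof (cases "x = y")
      case False
      show ?thesis
      proof (rule path_dist_Lipschitz_image[where \<phi> = "\<lambda>z. h *\<^sub>R G z" and S = X])
        show "(\<lambda>z. h *\<^sub>R G z) ` X \<subseteq> S"
          using S hk(1) by blast
        show "dist (h *\<^sub>R G u) (h *\<^sub>R G v) \<le> h * L * dist u v" if "u \<in> X" "v \<in> X" for u v
        proof -
          have "h * dist (G u) (G v) \<le> h * (L * dist u v)"
            using L(2) that h0 by (intro mult_left_mono) simp_all
          thus ?thesis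
            using h0 by (simp add: dist_norm mult.assoc flip: scaleR_diff_right)
        qed
        \<comment> \<open>The constant \<open>Q + 1\<close> instead of \<open>Q\<close> makes the inequality strict, as the infimum in the
            definition of the path distance need not be attained.\<close>
        have "path_dist X x y \<le> ennreal (Q * dist x y)"
          using xy by (rule quasiconvex)
        also have "\<dots> < ennreal ((Q + 1) * dist x y)"
          using False quasiconvex(1) by (intro ennreal_lessI mult_pos_pos mult_strict_right_mono) simp_all
        finally show "path_dist X x y < ennreal ((Q + 1) * dist x y)" .
      qed (use h0 L(1) quasiconvex(1) in simp_all)
    qed (use S xy hk in \<open>simp add: path_dist_self\<close>)
    have radial: "path_dist S (h *\<^sub>R G y) (k *\<^sub>R G y) \<le> ennreal ((k - h) * \<bar>M\<bar>)"
    proof -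
      have "closed_segment (h *\<^sub>R G y) (k *\<^sub>R G y) \<subseteq> S"
      proof
        fix z assume "z \<in> closed_segment (h *\<^sub>R G y) (k *\<^sub>R G y)"
        then obtain u where u: "0 \<le> u" "u \<le> 1" "z = (1 - u) *\<^sub>R (h *\<^sub>R G y) + u *\<^sub>R (k *\<^sub>R G y)"
          by (auto simp: in_segment)
        have "z = ((1 - u) * h + u * k) *\<^sub>R G y"
          by (simp add: u(3) scaleR_add_left)
        moreover have "(1 - u) * h + u * k = h + u * (k - h)"
          by (simp add: algebra_simps)
        moreover have "u * (k - h) \<ge> 0"
          using u hk by simp
        ultimately show "z \<in> S"
          using S[OF xy(2), of "(1 - u) * h + u * k"] hk by simp
      qed
      hence "path_dist S (h *\<^sub>R G y) (k *\<^sub>R G y) \<le> ennreal (dist (h *\<^sub>R G y) (k *\<^sub>R G y))"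
        by (rule path_dist_segment_le)
      also have "dist (h *\<^sub>R G y) (k *\<^sub>R G y) = (k - h) * norm (G y)"
        using hk by (simp add: dist_norm flip: scaleR_diff_left)
      also have "ennreal \<dots> \<le> ennreal ((k - h) * \<bar>M\<bar>)"
        using hk M[OF xy(2)] by (intro ennreal_leI mult_left_mono) simp_all
      finally show ?thesis .
    qed
    have "path_dist S (h *\<^sub>R G x) (k *\<^sub>R G y) \<le> path_dist S (h *\<^sub>R G x) (h *\<^sub>R G y) + path_dist S (h *\<^sub>R G y) (k *\<^sub>R G y)"
      by (rule path_dist_triangle)
    also have "\<dots> \<le> ennreal (h * L * ((Q + 1) * dist x y)) + ennreal ((k - h) * \<bar>M\<bar>)"
      by (intro add_mono level radial)
    also have "\<dots> = ennreal (h * L * ((Q + 1) * dist x y) + (k - h) * \<bar>M\<bar>)"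
      using h0 hk L(1) quasiconvex(1) by (intro ennreal_plus[symmetric] mult_nonneg_nonneg) simp_all
    also have "\<dots> \<le> ennreal (A * ((k - h) + h * dist x y))"
    proof (rule ennreal_leI)
      have "A * ((k - h) + h * dist x y) - (h * L * ((Q + 1) * dist x y) + (k - h) * \<bar>M\<bar>)
              = L * (Q + 1) * (k - h) + \<bar>M\<bar> * (h * dist x y)"
        by (simp add: A_def algebra_simps)
      moreover have "L * (Q + 1) * (k - h) \<ge> 0" "\<bar>M\<bar> * (h * dist x y) \<ge> 0"
        using h0 hk L(1) quasiconvex(1) by simp_all
      ultimately show "h * L * ((Q + 1) * dist x y) + (k - h) * \<bar>M\<bar> \<le> A * ((k - h) + h * dist x y)"
        by linarith
    qed
    finally show ?thesis
      using hk by (simp add: cone_gauge_def cone_point_def min_def)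
  qed
  have upper: "path_dist S (cone_point G p) (cone_point G q) \<le> ennreal (A * cone_gauge p q)"
    if pqD: "p \<in> D" "q \<in> D" for p q
  proof -
    obtain x h y k where pq: "p = (x, h)" "q = (y, k)" "x \<in> X" "y \<in> X" "h \<ge> R" "k \<ge> R"
      using pqD by (cases p; cases q) (auto simp: D_def)
    show ?thesis
      unfolding pq(1,2) using upper_ordered[of x y h k] upper_ordered[of y x k h] pq(3-)
      by (cases "h \<le> k") (simp_all add: cone_gauge_commute[of "(x, h)"] path_dist_commute)
  qed

  have "path_dist S u v < \<infinity>" if "u \<in> S" "v \<in> S" for u v
  proof -
    obtain p q where "p \<in> D" "q \<in> D" "u = cone_point G p" "v = cone_point G q"
      using \<open>u \<in> S\<close> \<open>v \<in> S\<close> unfolding S_def by blast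
    hence "path_dist S u v \<le> ennreal (A * cone_gauge p q)"
      by (simp add: upper)
    also have "\<dots> < \<infinity>"
      by simp
    finally show ?thesis .
  qed
  hence rc: "rectifiably_connected S"
    by (simp add: rectifiably_connected_def)

  have A0: "A \<ge> 0" and B0: "B \<ge> 0"
    using L(1) quasiconvex(1) by (simp_all add: A_def B_def)
  have AD: "A * cone_gauge p q \<ge> 0" if "p \<in> D" "q \<in> D" for p q
    using A0 D that by (intro mult_nonneg_nonneg cone_gauge_nonneg) auto
  have path: "mdist (path_metric S) (cone_point G p) (cone_point G q) \<le> A * cone_gauge p q"
    if "p \<in> D" "q \<in> D" for p q
    using upper[OF that] AD[OF that] by (simp add: mdist_path_metric[OF rc] enn2real_leI)
  have dist_le: "dist u v \<le> mdist (path_metric S) u v" if "u \<in> S" "v \<in> S" for u v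
  proof -
    have "enn2real (ennreal (dist u v)) \<le> enn2real (path_dist S u v)"
      using dist_le_path_dist rc that by (intro enn2real_mono) (simp_all add: rectifiably_connected_def)
    thus ?thesis
      by (simp add: mdist_path_metric[OF rc])
  qed
  have in_S: "cone_point G p \<in> S" if "p \<in> D" for p
    using that by (simp add: S_def)
  have "cone_chart D (cone_point G) (submetric euclidean_metric S)"
  proof (rule cone_chartI[OF _ D])
    show "mspace (submetric euclidean_metric S) = cone_point G ` D"
      by (simp add: S_def)
    show "mdist (submetric euclidean_metric S) (cone_point G p) (cone_point G q) \<le> A * cone_gauge p q"
      if "p \<in> D" "q \<in> D" for p q
      using order_trans[OF dist_le[OF in_S in_S] path] that by simp
    show "cone_gauge p q \<le> B * mdist (submetric euclidean_metric S) (cone_point G p) (cone_point G q)"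
      if "p \<in> D" "q \<in> D" for p q
      using lower[OF that] by simp
  qed
  moreover have "cone_chart D (cone_point G) (path_metric S)"
  proof (rule cone_chartI[OF _ D path])
    show "mspace (path_metric S) = cone_point G ` D"
      using mspace_path_metric[OF rc] by (simp add: S_def)
    show "cone_gauge p q \<le> B * mdist (path_metric S) (cone_point G p) (cone_point G q)"
      if "p \<in> D" "q \<in> D" for p q
      using order_trans[OF lower[OF that] mult_left_mono[OF dist_le[OF in_S in_S] B0]] that by simp
  qed
  ultimately show ?thesis
    using rc by (simp add: charted_cone_def cone_metrics_def S_def D_def)
qed

section \<open>Flat and spherical cones\<close>

lemma flat_cone_from_eq_cone_points:
  fixes f :: "'a \<Rightarrow> 'b::real_vector"
  assumes "R \<ge> 0"
  shows "flat_cone_from R (f ` X) = cone_point (\<lambda>x. (f x, 1::real)) ` (X \<times> {R..})"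
proof (intro equalityI subsetI)
  fix v assume "v \<in> flat_cone_from R (f ` X)"
  then obtain h x where "h \<ge> R" "x \<in> X" "v = (h *\<^sub>R f x, h)"
    by (auto simp: flat_cone_from_def flat_cone_def)
  thus "v \<in> cone_point (\<lambda>x. (f x, 1::real)) ` (X \<times> {R..})"
    by (intro image_eqI[of _ _ "(x, h)"]) (simp_all add: cone_point_def)
next
  fix v assume "v \<in> cone_point (\<lambda>x. (f x, 1::real)) ` (X \<times> {R..})"
  then obtain h x where v: "h \<ge> R" "x \<in> X" "v = (h *\<^sub>R f x, h)"
    by (auto simp: cone_point_def)
  have "v \<in> flat_cone (f ` X)"
    unfolding flat_cone_def using v assms by auto
  thus "v \<in> flat_cone_from R (f ` X)"
    using v by (simp add: flat_cone_from_def)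
qed

lemma spherical_cone_from_eq_cone_points:
  "spherical_cone_from R (g ` X) = cone_point g ` (X \<times> {R..})"
proof (intro equalityI subsetI)
  fix v assume "v \<in> spherical_cone_from R (g ` X)"
  then obtain h x where "h \<ge> R" "x \<in> X" "v = h *\<^sub>R g x"
    by (auto simp: spherical_cone_from_def)
  thus "v \<in> cone_point g ` (X \<times> {R..})"
    by (intro image_eqI[of _ _ "(x, h)"]) (simp_all add: cone_point_def)
qed (auto simp: spherical_cone_from_def cone_point_def)

lemma flat_cone_eq_from_0: "flat_cone Y = flat_cone_from 0 Y"
  by (auto simp: flat_cone_from_def flat_cone_def)

lemma spherical_cone_eq_from_0: "spherical_cone Y = spherical_cone_from 0 Y"
  by (simp add: spherical_cone_from_def spherical_cone_def)

lemma simplicial_complex_compact: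
  assumes "simplicial_complex K"
  shows "compact (\<Union>K)"
  using simplicial_complex_finite_polytopes[OF assms] by (intro compact_Union polytope_imp_compact)

lemma simplicial_complex_quasiconvex:
  assumes "simplicial_complex K" "connected (\<Union>K)"
  shows "\<exists>Q\<ge>0. \<forall>x\<in>\<Union>K. \<forall>y\<in>\<Union>K. path_dist (\<Union>K) x y \<le> ennreal (Q * dist x y)"
  using simplicial_complex_finite_polytopes[OF assms(1)] assms(2)
  by (rule connected_polytope_union_quasiconvex)

lemma bilipschitz_on_imp_continuous_on:
  assumes "bilipschitz_on X f"
  shows "continuous_on X f"
proof -
  obtain C where "C > 0"
    "\<forall>x\<in>X. \<forall>y\<in>X. dist (f x) (f y) \<le> C * dist x y \<and> dist x y \<le> C * dist (f x) (f y)"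
    using assms unfolding bilipschitz_on_def by (elim exE conjE)
  hence "C-lipschitz_on X f"
    by (intro lipschitz_onI) simp_all
  thus ?thesis
    by (rule lipschitz_on_continuous_on)
qed

text \<open>
  A flat cone is the cone over the embedding \<open>x \<mapsto> (f x, 1)\<close>, whose height is its last coordinate. In
  a spherical cone, the height of a point is its norm.
\<close>

lemma flat_cone_from_charted:
  fixes K :: "'a::euclidean_space set set" and f :: "'a \<Rightarrow> 'b::euclidean_space"
  assumes "simplicial_complex K" "connected (\<Union>K)" "pl_embedding K f" "R \<ge> 0"
  shows "charted_cone (\<Union>K \<times> {R..}) (cone_point (\<lambda>x. (f x, 1::real))) (flat_cone_from R (f ` \<Union>K))"
proof -
  obtain Q where Q: "Q \<ge> 0" "\<forall>x\<in>\<Union>K. \<forall>y\<in>\<Union>K. path_dist (\<Union>K) x y \<le> ennreal (Q * dist x y)"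
    using simplicial_complex_quasiconvex[OF assms(1,2)] by (elim exE conjE)
  note bilip = pl_embedding_imp_bilipschitz(2)[OF assms(3)]
  have "bounded (f ` \<Union>K)"
    using bilipschitz_on_imp_continuous_on[OF bilip] simplicial_complex_compact[OF assms(1)]
    by (intro compact_imp_bounded compact_continuous_image)
  then obtain M where M: "\<forall>v\<in>f ` \<Union>K. norm v \<le> M"
    unfolding bounded_iff by (elim exE)
  show ?thesis
    unfolding flat_cone_from_eq_cone_points[OF assms(4)]
  proof (rule cone_over_bilipschitz_embedding_charted[OF assms(4) Q(1)])
    show "path_dist (\<Union>K) x y \<le> ennreal (Q * dist x y)" if "x \<in> \<Union>K" "y \<in> \<Union>K" for x y
      using Q(2) that by blast
    show "bilipschitz_on (\<Union>K) (\<lambda>x. (f x, 1::real))"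
      using bilip by (simp add: bilipschitz_on_def dist_Pair_Pair)
    show "norm (f x, 1::real) \<le> M + 1" if "x \<in> \<Union>K" for x
    proof -
      have "norm (f x) \<le> M"
        using M that by blast
      moreover have "norm (f x, 1::real) \<le> norm (f x) + norm (1::real)"
        by (rule norm_Pair_le)
      ultimately show ?thesis
        by simp
    qed
    show "\<bar>h - k\<bar> \<le> norm (h *\<^sub>R (f x, 1::real) - k *\<^sub>R (f y, 1::real))" for x y and h k :: real
      using norm_snd_le[of "h - k" "h *\<^sub>R f x - k *\<^sub>R f y"] by simp
  qed
qed

lemma spherical_cone_from_charted:
  fixes K :: "'a::euclidean_space set set" and g :: "'a \<Rightarrow> 'b::euclidean_space"
  assumes "simplicial_complex K" "connected (\<Union>K)" "pl_embedding_sphere K g" "R \<ge> 0"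
  shows "charted_cone (\<Union>K \<times> {R..}) (cone_point g) (spherical_cone_from R (g ` \<Union>K))"
proof -
  obtain Q where Q: "Q \<ge> 0" "\<forall>x\<in>\<Union>K. \<forall>y\<in>\<Union>K. path_dist (\<Union>K) x y \<le> ennreal (Q * dist x y)"
    using simplicial_complex_quasiconvex[OF assms(1,2)] by (elim exE conjE)
  have unit: "norm (g x) = 1" if "x \<in> \<Union>K" for x
  proof -
    have "g ` \<Union>K \<subseteq> sphere 0 1"
      using assms(3) by (simp add: pl_embedding_sphere_def pl_map_sphere_def)
    hence "g x \<in> sphere 0 1"
      using that by blast
    thus ?thesis
      by simp
  qed
  show ?thesis
    unfolding spherical_cone_from_eq_cone_points
  proof (rule cone_over_bilipschitz_embedding_charted[OF assms(4) Q(1)])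
    show "path_dist (\<Union>K) x y \<le> ennreal (Q * dist x y)" if "x \<in> \<Union>K" "y \<in> \<Union>K" for x y
      using Q(2) that by blast
    show "bilipschitz_on (\<Union>K) g"
      using assms(3) by (rule pl_embedding_sphere_imp_bilipschitz)
    show "norm (g x) \<le> 1" if "x \<in> \<Union>K" for x
      using unit[OF that] by simp
    show "\<bar>h - k\<bar> \<le> norm (h *\<^sub>R g x - k *\<^sub>R g y)"
      if "x \<in> \<Union>K" "y \<in> \<Union>K" "h \<ge> 0" "k \<ge> 0" for x y h k
      using norm_triangle_ineq3[of "h *\<^sub>R g x" "k *\<^sub>R g y"] that by (simp add: unit)
  qed
qed

lemma flat_cone_spherical_cone_comparable:
  fixes K :: "'a::euclidean_space set set"
    and f :: "'a \<Rightarrow> 'b::euclidean_space" and g :: "'a \<Rightarrow> 'c::euclidean_space"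
  assumes "simplicial_complex K" "connected (\<Union>K)" "pl_embedding K f" "pl_embedding_sphere K g" "R \<ge> 0"
  shows "cones_comparable (flat_cone_from R (f ` \<Union>K)) (spherical_cone_from R (g ` \<Union>K)) (cone_map (\<Union>K) f g)"
proof (rule charted_cones_comparable)
  show "charted_cone (\<Union>K \<times> {R..}) (cone_point (\<lambda>x. (f x, 1::real))) (flat_cone_from R (f ` \<Union>K))"
    using assms(1,2,3,5) by (rule flat_cone_from_charted)
  show "charted_cone (\<Union>K \<times> {R..}) (cone_point g) (spherical_cone_from R (g ` \<Union>K))"
    using assms(1,2,4,5) by (rule spherical_cone_from_charted)
  show "\<Union>K \<times> {R..} \<subseteq> UNIV \<times> {0..}"
    using assms(5) by auto
  show "cone_map (\<Union>K) f g (cone_point (\<lambda>x. (f x, 1::real)) p) = cone_point g p" if "p \<in> \<Union>K \<times> {R..}" for p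
  proof -
    have "fst p \<in> \<Union>K"
      using that by (simp add: mem_Times_iff)
    thus ?thesis
      using cone_map_eq[OF pl_embedding_imp_bilipschitz(1)[OF assms(3)]]
      by (simp add: cone_point_def split_beta)
  qed
qed

theorem lemma3p3:
  fixes K :: "'a::euclidean_space set set"
  assumes "simplicial_complex K" and "connected (\<Union>K)"
  shows
    "(\<forall>(f :: 'a \<Rightarrow> real ^ 'n) (g :: 'a \<Rightarrow> real ^ 'm).
        pl_embedding K f \<and> pl_embedding_sphere K g \<longrightarrow>
          cones_comparable (flat_cone (f ` \<Union>K)) (spherical_cone (g ` \<Union>K)) (cone_map (\<Union>K) f g) \<and>
          (\<forall>R>0. cones_comparable (flat_cone_from R (f ` \<Union>K)) (spherical_cone_from R (g ` \<Union>K))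
                   (cone_map (\<Union>K) f g)))
   \<and> (\<forall>(f :: 'a \<Rightarrow> real ^ 'n) (g :: 'a \<Rightarrow> real ^ 'm).
        pl_embedding K f \<and> pl_embedding_sphere K g \<longrightarrow>
          same_bilipschitz_class (flat_cone (f ` \<Union>K)) (spherical_cone (g ` \<Union>K)) \<and>
          (\<forall>R>0. same_bilipschitz_class (flat_cone_from R (f ` \<Union>K)) (spherical_cone_from R (g ` \<Union>K))))
   \<and> (\<forall>(f :: 'a \<Rightarrow> real ^ 'n) (f' :: 'a \<Rightarrow> real ^ 'k).
        pl_embedding K f \<and> pl_embedding K f' \<longrightarrow>
          same_bilipschitz_class (flat_cone (f ` \<Union>K)) (flat_cone (f' ` \<Union>K)) \<and>
          (\<forall>R>0. same_bilipschitz_class (flat_cone_from R (f ` \<Union>K)) (flat_cone_from R (f' ` \<Union>K))))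
   \<and> (\<forall>(g :: 'a \<Rightarrow> real ^ 'm) (g' :: 'a \<Rightarrow> real ^ 'l).
        pl_embedding_sphere K g \<and> pl_embedding_sphere K g' \<longrightarrow>
          same_bilipschitz_class (spherical_cone (g ` \<Union>K)) (spherical_cone (g' ` \<Union>K)) \<and>
          (\<forall>R>0. same_bilipschitz_class (spherical_cone_from R (g ` \<Union>K)) (spherical_cone_from R (g' ` \<Union>K))))"
proof -
  have heights: "\<Union>K \<times> {R..} \<subseteq> UNIV \<times> {0::real..}" if "R \<ge> 0" for R
    using that by auto
  note flat = flat_cone_from_charted[OF assms] and spherical = spherical_cone_from_charted[OF assms]
  note same = charted_cones_same_bilipschitz_class[OF _ _ heights]
  show ?thesis
    unfolding flat_cone_eq_from_0 spherical_cone_eq_from_0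
    by (intro conjI allI impI;
        (elim conjE)?;
        (rule flat_cone_spherical_cone_comparable[OF assms] same[OF flat spherical]
           same[OF flat flat] same[OF spherical spherical]);
        simp)
qed

end
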